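(* Let $\alpha\in(0,1]$, let $f\in C^\infty(\mathbb{R},\mathbb{R})$ and $K>0$ be such that $$f'(0)=0\quad\text{and}\quad\inf_{s\in[-K,K]}|f''(s)|>0,$$ and let $a$ satisfy condition (A) of the context and be such that there exist a nonempty open interval $\omega\subset\mathbb{T}$ and $\delta>0$ with $a(x)\ge\delta$ for all $x\in\omega$. Then, for any $u_0\in L^\infty(\mathbb{T})$ satisfying $\|u_0\|_{L^\infty(\mathbb{T})}\le K$, the solution $u$ of $$\partial_t u+\partial_x(f(u))+a(x)\frac{u}{|u|^\alpha}=0\quad\text{in }\mathbb{R}_+\times\mathbb{T},\qquad u_{|t=0}=u_0,$$ satisfies the following property: there exist a time $t_*>0$ and a constant $C>0$ such that for all $t\ge t_*$ there exists an open subinterval $\omega(t)\subset\omega$ such that $u(t)_{|\omega(t)}=0$ (a.e.), and, for all $t\ge t_*$, $$|\omega\setminus\omega(t)|\le\frac{C}{t^{1+\alpha}},\qquad\|u(t)\|_{L^\infty(\mathbb{T})}\le\frac{C}{t}.$$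
   Context: $\mathbb{T}=\mathbb{R}/\mathbb{Z}$, $\mathbb{R}_+=[0,\infty)$; $|E|$ is the Lebesgue measure of $E\subset\mathbb{T}$. Condition (A) on $a:\mathbb{T}\to\mathbb{R}$: $a(x)\ge 0$ for all $x\in\mathbb{T}$, $a\in L^\infty(\mathbb{T})$, and $\sup_{y>0}\frac1y\int_{\mathbb{T}}|a(x+y)-a(x)|\,dx<\infty$. $\mathrm{Sign}(u)=\{1\}$ if $u>0$, $\{-1\}$ if $u<0$, $[-1,1]$ if $u=0$. For $\alpha<1$, $u/|u|^\alpha$ is understood as $0$ at $u=0$. Admissible weak solution on $[0,T]\times\mathbb{T}$ with initial datum $u_0\in L^\infty(\mathbb{T})$: (Case $0<\alpha<1$.) A bounded measurable function $u$ on $[0,T]\times\mathbb{T}$ such that, with $h(t,x)=a(x)\frac{u(t,x)}{|u(t,x)|^\alpha}$, $$\int_0^T\!\!\int_{\mathbb{T}}\big(\partial_t\psi\,\eta(u)+\partial_x\psi\,q(u)-\psi\,\eta'(u)\,h\big)\,dx\,dt+\int_{\mathbb{T}}\psi(0,x)\eta(u_0(x))\,dx\ge 0\qquad( * )$$ for every convex (hence locally Lipschitz) function $\eta:\mathbb{R}\to\mathbb{R}$, with $q$ such that $q'=f'\eta'$, and every nonnegative Lipschitz continuous $\psi$ on $[0,T]\times\mathbb{T}$ with $\psi(T,\cdot)=0$. At points where $\eta$ is not differentiable, $\eta'$ denotes the average of the left and right derivatives. (Case $\alpha=1$.) A bounded measurable function $u$ on $[0,T]\times\mathbb{T}$ for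 which there exists $h\in L^\infty((0,T)\times\mathbb{T})$ with $\partial_t u+\partial_x(f(u))+h=0$ in $\mathscr{D}'((0,T)\times\mathbb{T})$, $h(t,x)\in a(x)\,\mathrm{Sign}(u(t,x))$ for a.e. $(t,x)\in(0,T)\times\mathbb{T}$, and such that $( * )$ holds with this $h$ for every convex (hence locally Lipschitz) function $\eta:\mathbb{R}\to\mathbb{R}$, with $q$ such that $q'=f'\eta'$, and every nonnegative Lipschitz continuous $\psi$ on $[0,T]\times\mathbb{T}$ with $\psi(T,\cdot)=0$ (with $\eta'$ again denoting the average of the left and right derivatives at points where $\eta$ is not differentiable). "The solution" means the global admissible weak solution (admissible weak solution on $[0,T]\times\mathbb{T}$ for every $T>0$), which exists, is unique, and is taken in its $C^0(\mathbb{R}_+;L^1(\mathbb{T}))$ representative, so that $u(t)$ makes sense for every $t\ge 0$. *)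

theory Defs
  imports
    "HOL-Analysis.Analysis"
    "HOL-Probability.Essential_Supremum"
    "HOL-Library.Periodic_Fun"
begin

text \<open>
  The circle \<open>\<real>/\<int>\<close> is handled through the covering \<open>\<real> \<rightarrow> \<real>/\<int>\<close>: a function on the circle is a
  1-periodic function on \<open>\<real>\<close> (predicate \<open>periodic_fun_simple'\<close> of the library), a subset
  of the circle is its 1-periodic preimage in \<open>\<real>\<close>, and Lebesgue measure on the circle is Lebesgue
  measure on the fundamental domain \<open>[0,1)\<close>.  A function of time and space is written
  \<open>u t x\<close>.
\<close>

abbreviation circ :: "real measure"
  where "circ \<equiv> lebesgue_on {0..<1}"

abbreviation strip :: "real \<Rightarrow> (real \<times> real) measure"
  where "strip T \<equiv> lebesgue_on ({0..T} \<times> {0..<1})"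

definition circ_measure :: "real set \<Rightarrow> real"
  where "circ_measure E = measure lebesgue (E \<inter> {0..<1})"

text \<open>Nonempty open intervals of the circle: images of nonempty open intervals of \<open>\<real>\<close>.\<close>

definition open_arc :: "real set \<Rightarrow> bool"
  where "open_arc W \<longleftrightarrow> (\<exists>l r. l < r \<and> W = {x. \<exists>k::int. x + of_int k \<in> {l<..<r}})"

definition Linfty_norm :: "(real \<Rightarrow> real) \<Rightarrow> ereal"
  where "Linfty_norm g = esssup circ (\<lambda>x. ereal \<bar>g x\<bar>)"

definition Linfty :: "(real \<Rightarrow> real) \<Rightarrow> bool"
  where "Linfty g \<longleftrightarrow>
    periodic_fun_simple' g \<and> g \<in> borel_measurable circ \<and> Linfty_norm g < \<infinity>"

definition condition_A :: "(real \<Rightarrow> real) \<Rightarrow> bool"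
  where "condition_A a \<longleftrightarrow>
    (\<forall>x. a x \<ge> 0) \<and> Linfty a \<and>
    bdd_above ((\<lambda>y. 1 / y * (\<integral>x. \<bar>a (x + y) - a x\<bar> \<partial>circ)) ` {0<..})"

primrec C_k :: "nat \<Rightarrow> ('a::euclidean_space \<Rightarrow> 'b::real_normed_vector) \<Rightarrow> bool"
  where
    "C_k 0 g \<longleftrightarrow> continuous_on UNIV g"
  | "C_k (Suc n) g \<longleftrightarrow>
      (\<forall>x. g differentiable (at x)) \<and> (\<forall>v. C_k n (\<lambda>x. frechet_derivative g (at x) v))"

definition C_infinity :: "('a::euclidean_space \<Rightarrow> 'b::real_normed_vector) \<Rightarrow> bool"
  where "C_infinity g \<longleftrightarrow> (\<forall>n. C_k n g)"

definition Sign :: "real \<Rightarrow> real set"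
  where "Sign u = (if u > 0 then {1} else if u < 0 then {-1} else {-1..1})"

text \<open>
  The average of the left and right derivatives; for a convex function both exist everywhere and
  this is the derivative wherever the function is differentiable.
\<close>

definition avg_deriv :: "(real \<Rightarrow> real) \<Rightarrow> real \<Rightarrow> real"
  where "avg_deriv \<eta> s =
    (vector_derivative \<eta> (at_left s) + vector_derivative \<eta> (at_right s)) / 2"

text \<open>
  The relation \<open>q' = f' \<eta>'\<close>, in integrated form because \<open>\<eta>'\<close> may have jumps.
\<close>

definition entropy_flux :: "(real \<Rightarrow> real) \<Rightarrow> (real \<Rightarrow> real) \<Rightarrow> (real \<Rightarrow> real) \<Rightarrow> bool"
  where "entropy_flux f \<eta> q \<longleftrightarrow>
    (\<forall>r s. r \<le> s \<longrightarrow> ((\<lambda>v. deriv f v * avg_deriv \<eta> v) has_integral (q s - q r)) {r..s})"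

definition lipschitz_test :: "real \<Rightarrow> (real \<Rightarrow> real \<Rightarrow> real) \<Rightarrow> bool"
  where "lipschitz_test T \<psi> \<longleftrightarrow>
    (\<forall>t\<in>{0..T}. periodic_fun_simple' (\<psi> t)) \<and>
    (\<forall>t\<in>{0..T}. \<forall>x. \<psi> t x \<ge> 0) \<and>
    (\<exists>L. L-lipschitz_on ({0..T} \<times> UNIV) (\<lambda>(t, x). \<psi> t x)) \<and>
    (\<forall>x. \<psi> T x = 0)"

text \<open>
  A Lipschitz \<open>\<psi>\<close> has partial derivatives only almost everywhere; the values of \<open>deriv\<close>
  on the exceptional null set do not affect the integral.
\<close>

definition entropy_inequality ::
    "(real \<Rightarrow> real) \<Rightarrow> real \<Rightarrow> (real \<Rightarrow> real) \<Rightarrow> (real \<Rightarrow> real \<Rightarrow> real) \<Rightarrow> (real \<Rightarrow> real \<Rightarrow> real) \<Rightarrow> bool"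
  where "entropy_inequality f T u0 u h \<longleftrightarrow>
    (\<forall>\<eta> q \<psi>. convex_on UNIV \<eta> \<and> entropy_flux f \<eta> q \<and> lipschitz_test T \<psi> \<longrightarrow>
      (\<integral>(t, x). deriv (\<lambda>s. \<psi> s x) t * \<eta> (u t x) + deriv (\<lambda>y. \<psi> t y) x * q (u t x)
          - \<psi> t x * avg_deriv \<eta> (u t x) * h t x \<partial>strip T)
        + (\<integral>x. \<psi> 0 x * \<eta> (u0 x) \<partial>circ) \<ge> 0)"

text \<open>Test functions in \<open>C\<^sub>c\<^sup>\<infinity>((0,T) \<times> \<real>/\<int>)\<close>, extended by zero to all times.\<close>

definition smooth_test :: "real \<Rightarrow> (real \<Rightarrow> real \<Rightarrow> real) \<Rightarrow> bool"
  where "smooth_test T \<phi> \<longleftrightarrow>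
    (\<forall>t. periodic_fun_simple' (\<phi> t)) \<and>
    C_infinity (\<lambda>(t, x). \<phi> t x) \<and>
    (\<exists>r s. 0 < r \<and> r \<le> s \<and> s < T \<and> (\<forall>t x. t \<notin> {r..s} \<longrightarrow> \<phi> t x = 0))"

text \<open>The equation \<open>\<partial>\<^sub>t u + \<partial>\<^sub>x (f(u)) + h = 0\<close> in the sense of distributions.\<close>

definition distributional_eq ::
    "(real \<Rightarrow> real) \<Rightarrow> real \<Rightarrow> (real \<Rightarrow> real \<Rightarrow> real) \<Rightarrow> (real \<Rightarrow> real \<Rightarrow> real) \<Rightarrow> bool"
  where "distributional_eq f T u h \<longleftrightarrow>
    (\<forall>\<phi>. smooth_test T \<phi> \<longrightarrow>
      (\<integral>(t, x). - (deriv (\<lambda>s. \<phi> s x) t * u t x) - deriv (\<lambda>y. \<phi> t y) x * f (u t x)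
          + \<phi> t x * h t x \<partial>strip T) = 0)"

definition bounded_measurable :: "real \<Rightarrow> (real \<Rightarrow> real \<Rightarrow> real) \<Rightarrow> bool"
  where "bounded_measurable T u \<longleftrightarrow>
    (\<forall>t\<in>{0..T}. periodic_fun_simple' (u t)) \<and>
    (\<lambda>(t, x). u t x) \<in> borel_measurable (strip T) \<and>
    bounded ((\<lambda>(t, x). u t x) ` ({0..T} \<times> UNIV))"

text \<open>Membership in \<open>L\<^sup>\<infinity>((0,T) \<times> \<real>/\<int>)\<close>; the time endpoints are a null set of \<open>strip T\<close>.\<close>

definition Linfty_strip :: "real \<Rightarrow> (real \<Rightarrow> real \<Rightarrow> real) \<Rightarrow> bool"
  where "Linfty_strip T h \<longleftrightarrow>
    (\<forall>t\<in>{0<..<T}. periodic_fun_simple' (h t)) \<and>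
    (\<lambda>(t, x). h t x) \<in> borel_measurable (strip T) \<and>
    esssup (strip T) (\<lambda>(t, x). ereal \<bar>h t x\<bar>) < \<infinity>"

text \<open>
  Below, \<open>u / \<bar>u\<bar> powr \<alpha>\<close> is \<open>0\<close> at \<open>u = 0\<close>, as required for \<open>\<alpha> < 1\<close>.
\<close>

definition admissible_weak_solution ::
    "real \<Rightarrow> (real \<Rightarrow> real) \<Rightarrow> (real \<Rightarrow> real) \<Rightarrow> real \<Rightarrow> (real \<Rightarrow> real) \<Rightarrow> (real \<Rightarrow> real \<Rightarrow> real) \<Rightarrow> bool"
  where "admissible_weak_solution \<alpha> f a T u0 u \<longleftrightarrow>
    bounded_measurable T u \<and>
    (if \<alpha> < 1 then
       entropy_inequality f T u0 u (\<lambda>t x. a x * (u t x / \<bar>u t x\<bar> powr \<alpha>))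
     else
       (\<exists>h. Linfty_strip T h \<and>
            distributional_eq f T u h \<and>
            (AE (t, x) in strip T. h t x \<in> (\<lambda>s. a x * s) ` Sign (u t x)) \<and>
            entropy_inequality f T u0 u h))"

definition continuous_into_L1 :: "(real \<Rightarrow> real \<Rightarrow> real) \<Rightarrow> bool"
  where "continuous_into_L1 u \<longleftrightarrow>
    (\<forall>t\<ge>0. periodic_fun_simple' (u t) \<and> integrable circ (u t)) \<and>
    (\<forall>t\<ge>0. ((\<lambda>s. \<integral>x. \<bar>u s x - u t x\<bar> \<partial>circ) \<longlongrightarrow> 0) (at t within {0..}))"

text \<open>
  The global admissible weak solution, in its representative that is continuous in time with
  values in \<open>L\<^sup>1\<close>.
\<close>

definition global_solution ::
    "real \<Rightarrow> (real \<Rightarrow> real) \<Rightarrow> (real \<Rightarrow> real) \<Rightarrow> (real \<Rightarrow> real) \<Rightarrow> (real \<Rightarrow> real \<Rightarrow> real) \<Rightarrow> bool"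
  where "global_solution \<alpha> f a u0 u \<longleftrightarrow>
    (\<forall>T>0. admissible_weak_solution \<alpha> f a T u0 u) \<and> continuous_into_L1 u"

end

theory Submission
  imports Defs
begin

text \<open>
  Suppose that \<open>f''\<close> has the sign \<open>\<kappa>\<close> on \<open>[-K, K]\<close>, let \<open>\<tau> = \<plusminus>1\<close> and put \<open>U = \<tau> u\<close>.  Where \<open>U\<close>
  is positive, characteristics run in the single direction \<open>\<sigma> = \<kappa> \<tau>\<close>, with a speed \<open>\<sigma> f'(\<tau> U)\<close> that is
  comparable to \<open>U\<close>, and along them \<open>U\<close> decreases at the rate \<open>a U powr (1 - \<alpha>)\<close>.  Inside \<open>\<omega>\<close> this reads
  \<open>dU/dy \<le> - const * U powr (-\<alpha>)\<close> in the position \<open>y\<close>, so \<open>U powr (1 + \<alpha>)\<close> falls linearly in \<open>y\<close>.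
  Two things follow.  A value \<open>M\<close> goes round the circle in a time of order \<open>1 / M\<close> and loses a fixed
  fraction on the way, whence \<open>U \<le> C / t\<close>.  A value \<open>M\<close> that enters \<open>\<omega>\<close> dies within a distance of order
  \<open>M powr (1 + \<alpha>)\<close>, hence within \<open>C / t powr (1 + \<alpha>)\<close> at time \<open>t\<close>.  The choice \<open>\<tau> = 1\<close> bounds the positive
  part of \<open>u\<close> and \<open>\<tau> = -1\<close> the negative part, which enters \<open>\<omega>\<close> at the opposite end; between the two
  boundary layers \<open>u\<close> vanishes.

  Entropy solutions are brought into this picture by a comparison principle (\<open>comparison\<close>).  To prove
  \<open>U \<le> k + w\<close> for a barrier \<open>w(t, y) > 0\<close>, use the entropy \<open>(max 0 (U - k))^p\<close> with the test function
  \<open>(T - t) \<theta> w^(-p)\<close>, where \<open>\<theta>\<close> is a cutoff.  The entropy flux is \<open>c\<close> times the entropy, with \<open>c\<close> an average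
  of the speeds between \<open>k\<close> and \<open>U\<close>; therefore all terms carrying a factor \<open>p\<close> combine into \<open>-p\<close> times the
  supersolution expression \<open>w\<^sub>t + c w\<^sub>y + damping\<close>.  If that is nonnegative, what remains bounds
  \<open>\<integral> \<theta> (max 0 (U - k) / w)^p\<close> independently of \<open>p\<close>, and \<open>p \<rightarrow> \<infinity>\<close> yields the claim.

  Two explicit barriers suffice, both at the level \<open>k = M / 2\<close>, which keeps the damping term away from
  its singularity at \<open>0\<close> and makes the estimates invariant under scaling.  In \<open>damping_step\<close> the
  barrier decreases into \<open>\<omega>\<close>; in \<open>transport_step\<close> it is a front that carries the decrease once around
  the circle.  Together they give \<open>contraction\<close>: a bound \<open>M\<close> improves to \<open>q M\<close> with a fixed \<open>q < 1\<close> in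
  time \<open>C / M\<close>.  Iterating this gives \<open>decay\<close>, where the times form a geometric series dominated by its
  last term.  Iterating \<open>damping_step\<close> infinitely often inside \<open>\<omega>\<close> gives \<open>extinction\<close>, where the lengths
  \<open>M powr (1 + \<alpha>)\<close> and times \<open>M powr \<alpha>\<close> are summable.  Continuity in time with values in \<open>L\<^sup>1\<close> turns these
  statements about almost every \<open>(t, x)\<close> into statements about every \<open>t\<close> (\<open>le_after_slice\<close>).
\<close>

section \<open>Smooth fluxes and smooth cutoffs\<close>

lemma C_infinity_deriv:
  fixes f :: "real \<Rightarrow> real"
  assumes "C_infinity f"
  shows "f differentiable (at x)" and "C_infinity (deriv f)"
proof -
  have d: "\<forall>x. f differentiable (at x)"
    using assms unfolding C_infinity_def by (metis C_k.simps(2))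
  then show "f differentiable (at x)" by blast
  have eq: "(\<lambda>x. frechet_derivative f (at x) 1) = deriv f"
  proof
    fix x
    have "(f has_real_derivative deriv f x) (at x)"
      using d DERIV_deriv_iff_real_differentiable by blast
    then have "(f has_derivative (*) (deriv f x)) (at x)"
      by (simp add: has_field_derivative_def)
    then show "frechet_derivative f (at x) 1 = deriv f x"
      by (metis frechet_derivative_at mult.right_neutral)
  qed
  have "C_k n (deriv f)" for n
    using assms unfolding C_infinity_def by (metis C_k.simps(2) eq)
  then show "C_infinity (deriv f)" unfolding C_infinity_def by blast
qed

lemma C_infinity_continuous_on:
  fixes f :: "real \<Rightarrow> real"
  assumes "C_infinity f"
  shows "continuous_on A f"
  using assms unfolding C_infinity_def
  by (metis C_k.simps(1) continuous_on_subset subset_UNIV)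

lemma C_infinity_has_deriv:
  fixes f :: "real \<Rightarrow> real"
  assumes "C_infinity f"
  shows "(f has_real_derivative deriv f x) (at x)"
  using C_infinity_deriv(1)[OF assms] DERIV_deriv_iff_real_differentiable by blast

text \<open>
  By the intermediate value theorem a continuous function that stays away from \<open>0\<close> has one sign, so
  the flux is uniformly convex (\<open>\<kappa> = 1\<close>) or uniformly concave (\<open>\<kappa> = -1\<close>) on the range of the solution.
\<close>

lemma convex_or_concave:
  fixes g :: "real \<Rightarrow> real"
  assumes cont: "continuous_on {-K..K} g" and K: "K > 0"
    and inf: "(INF s\<in>{-K..K}. \<bar>g s\<bar>) > 0"
  obtains \<kappa> c0 c1 :: real where "\<kappa> \<in> {1,-1}" "0 < c0"
    "\<And>s. s \<in> {-K..K} \<Longrightarrow> c0 \<le> \<kappa> * g s \<and> \<kappa> * g s \<le> c1"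
proof -
  define c0 where "c0 = (INF s\<in>{-K..K}. \<bar>g s\<bar>)"
  have low: "c0 \<le> \<bar>g s\<bar>" if "s \<in> {-K..K}" for s
    unfolding c0_def by (rule cINF_lower) (use that in \<open>auto intro!: bdd_belowI2[where m=0]\<close>)
  have "compact (g ` {-K..K})" using cont by (intro compact_continuous_image) auto
  then obtain c1 where c1: "\<And>s. s \<in> {-K..K} \<Longrightarrow> \<bar>g s\<bar> \<le> c1"
    by (meson bounded_real compact_imp_bounded imageI)
  define \<kappa> where "\<kappa> = sgn (g 0)"
  have g0: "g 0 \<noteq> 0" using low[of 0] K inf c0_def by auto
  have "\<kappa> * g s = \<bar>g s\<bar>" if s: "s \<in> {-K..K}" for s
  proof (rule ccontr)
    assume "\<kappa> * g s \<noteq> \<bar>g s\<bar>"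
    then have sgns: "(g 0 < 0 \<and> 0 < g s) \<or> (g 0 > 0 \<and> 0 > g s)"
      using g0 unfolding \<kappa>_def by (cases "g s" "0::real" rule: linorder_cases; cases "g 0" "0::real" rule: linorder_cases) auto
    have "connected (g ` {-K..K})" by (intro connected_continuous_image cont) auto
    moreover have "g 0 \<in> g ` {-K..K}" "g s \<in> g ` {-K..K}" using s K by auto
    ultimately have "0 \<in> g ` {-K..K}" using sgns connectedD_interval[of "g ` {-K..K}"]
      by (metis less_imp_le)
    then obtain z where "z \<in> {-K..K}" "g z = 0" by auto
    then show False using low[of z] inf c0_def by auto
  qed
  moreover have "\<kappa> \<in> {1,-1}" using g0 unfolding \<kappa>_def by (auto simp: sgn_if)
  moreover have "c0 > 0" using inf c0_def by simp
  ultimately show ?thesis using that[of \<kappa> c0 c1] low c1 by metis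
qed

definition pos_sq :: "real \<Rightarrow> real"
  where "pos_sq x = (max 0 x)\<^sup>2"

text \<open>
  Powers of the positive part from the square on are continuously differentiable; entropies, cutoffs
  and barriers are all built from them, so that every derivative below exists at every point.
\<close>

lemma pos_power_has_deriv:
  fixes x :: real
  shows "((\<lambda>x. (max 0 x) ^ Suc (Suc n)) has_real_derivative real (Suc (Suc n)) * (max 0 x) ^ Suc n) (at x)"
proof -
  consider "x < 0" | "x = 0" | "x > 0" by linarith
  then show ?thesis
  proof cases
    case 1
    have "((\<lambda>x. 0) has_real_derivative 0) (at x)" by simp
    then show ?thesis
      by (rule DERIV_cong[OF has_field_derivative_transform_within_open[where S="{..<0}"]]) (use 1 in auto)
  next
    case 3
    have "((\<lambda>x. x ^ Suc (Suc n)) has_real_derivative real (Suc (Suc n)) * x ^ Suc n) (at x)"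
      by (rule DERIV_cong[OF DERIV_pow]) simp
    then show ?thesis
      by (rule DERIV_cong[OF has_field_derivative_transform_within_open[where S="{0<..}"]]) (use 3 in auto)
  next
    case 2
    have "((\<lambda>h. (max 0 h) ^ Suc (Suc n) / h) \<longlongrightarrow> 0) (at (0::real))"
    proof (rule Lim_null_comparison[where g="\<lambda>h. \<bar>h\<bar> ^ Suc n"])
      have "norm (max 0 h ^ Suc (Suc n) / h) \<le> \<bar>h\<bar> ^ Suc n" for h :: real
      proof (cases "h > 0")
        case False
        then have "norm (max 0 h ^ Suc (Suc n) / h) = 0" by (simp add: max.absorb1)
        then show ?thesis by (metis abs_ge_zero zero_le_power)
      qed simp
      then show "\<forall>\<^sub>F h in at (0::real). norm (max 0 h ^ Suc (Suc n) / h) \<le> \<bar>h\<bar> ^ Suc n"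
        by (rule always_eventually[OF allI])
      have "((\<lambda>h::real. \<bar>h\<bar> ^ Suc n) \<longlongrightarrow> \<bar>0\<bar> ^ Suc n) (at 0)"
        by (intro tendsto_intros)
      then show "((\<lambda>h::real. \<bar>h\<bar> ^ Suc n) \<longlongrightarrow> 0) (at 0)" by simp
    qed
    then show ?thesis unfolding DERIV_def using 2 by simp
  qed
qed

lemma pos_sq_deriv [derivative_intros]:
  assumes "(g has_real_derivative g') (at x)"
  shows "((\<lambda>x. pos_sq (g x)) has_real_derivative 2 * max 0 (g x) * g') (at x)"
  unfolding pos_sq_def
  using DERIV_chain2[OF pos_power_has_deriv[of 0, simplified] assms] 
  by (simp add: power2_eq_square)

text \<open>A continuously differentiable step: the quadratic spline that rises from 0 to 1 on \<open>[0,1]\<close>.\<close>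

definition smooth_step :: "real \<Rightarrow> real"
  where "smooth_step x = 2 * pos_sq x - 4 * pos_sq (x - 1/2) + 2 * pos_sq (x - 1)"

definition smooth_step' :: "real \<Rightarrow> real"
  where "smooth_step' x = 4 * max 0 x - 8 * max 0 (x - 1/2) + 4 * max 0 (x - 1)"

lemma smooth_step_deriv [derivative_intros]:
  assumes "(g has_real_derivative g') (at x)"
  shows "((\<lambda>x. smooth_step (g x)) has_real_derivative smooth_step' (g x) * g') (at x)"
  unfolding smooth_step_def smooth_step'_def
  by (rule derivative_eq_intros assms refl | simp)+ (simp add: algebra_simps)

lemma smooth_step'_bounds: "0 \<le> smooth_step' x" "smooth_step' x \<le> 2"
  unfolding smooth_step'_def max_def by auto

lemma smooth_step'_eq_0: "x \<le> 0 \<or> 1 \<le> x \<Longrightarrow> smooth_step' x = 0"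
  unfolding smooth_step'_def max_def by auto

lemma smooth_step_eq_0: "x \<le> 0 \<Longrightarrow> smooth_step x = 0"
  unfolding smooth_step_def pos_sq_def max_def by auto

lemma smooth_step_eq_1: "1 \<le> x \<Longrightarrow> smooth_step x = 1"
  unfolding smooth_step_def pos_sq_def max_def by (auto simp: power2_eq_square algebra_simps)

lemma smooth_step_mono: "x \<le> y \<Longrightarrow> smooth_step x \<le> smooth_step y"
  using DERIV_nonneg_imp_nondecreasing[of x y smooth_step]
    smooth_step_deriv[OF DERIV_ident] smooth_step'_bounds(1) by (metis mult.right_neutral)

lemma smooth_step_bounds: "0 \<le> smooth_step x" "smooth_step x \<le> 1"
  using smooth_step_mono[of "min x 0" x] smooth_step_eq_0[of "min x 0"]
    smooth_step_mono[of x "max x 1"] smooth_step_eq_1[of "max x 1"] by auto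

lemma smooth_step_pos: "0 < x \<Longrightarrow> 0 < smooth_step x"
proof -
  assume x: "0 < x"
  have "0 < smooth_step (min x (1/4))"
    using x unfolding smooth_step_def pos_sq_def max_def by (auto simp: min_def)
  also have "\<dots> \<le> smooth_step x" by (rule smooth_step_mono) simp
  finally show ?thesis .
qed

lemma continuous_on_pos_sq [continuous_intros]:
  "continuous_on A g \<Longrightarrow> continuous_on A (\<lambda>x. pos_sq (g x))"
  unfolding pos_sq_def by (intro continuous_intros)

lemma continuous_on_smooth_step [continuous_intros]:
  "continuous_on A g \<Longrightarrow> continuous_on A (\<lambda>x. smooth_step (g x))"
  unfolding smooth_step_def by (intro continuous_intros)

lemma continuous_on_smooth_step' [continuous_intros]:
  "continuous_on A g \<Longrightarrow> continuous_on A (\<lambda>x. smooth_step' (g x))"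
  unfolding smooth_step'_def by (intro continuous_intros)

section \<open>Test functions on the circle\<close>

lemma partial_derivatives_imp_lipschitz:
  fixes \<psi> \<psi>t \<psi>x :: "real \<Rightarrow> real \<Rightarrow> real"
  assumes t: "\<And>t x. ((\<lambda>s. \<psi> s x) has_real_derivative \<psi>t t x) (at t)"
    and x: "\<And>t x. t \<in> {0..T} \<Longrightarrow> (\<psi> t has_real_derivative \<psi>x t x) (at x)"
    and bt: "\<And>t x. t \<in> {0..T} \<Longrightarrow> \<bar>\<psi>t t x\<bar> \<le> L"
    and bx: "\<And>t x. t \<in> {0..T} \<Longrightarrow> \<bar>\<psi>x t x\<bar> \<le> L"
    and L: "0 \<le> L"
  shows "(2 * L)-lipschitz_on ({0..T} \<times> UNIV) (\<lambda>(t, x). \<psi> t x)"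
proof (rule lipschitz_onI)
  fix p p' :: "real \<times> real"
  assume p: "p \<in> {0..T} \<times> UNIV" and p': "p' \<in> {0..T} \<times> UNIV"
  obtain t x where tx: "p = (t, x)" by fastforce
  obtain t' x' where tx': "p' = (t', x')" by fastforce
  have t_in: "t \<in> {0..T}" "t' \<in> {0..T}" using p p' tx tx' by auto
  have "norm (\<psi> t x - \<psi> t' x) \<le> L * norm (t - t')"
    by (rule field_differentiable_bound[where S="{0..T}" and f'="\<lambda>s. \<psi>t s x"])
      (use t bt t_in in \<open>auto intro: has_field_derivative_at_within\<close>)
  moreover have "norm (\<psi> t' x - \<psi> t' x') \<le> L * norm (x - x')"
    by (rule field_differentiable_bound[where S=UNIV and f'="\<lambda>s. \<psi>x t' s"])
      (use x bx t_in in \<open>auto intro: has_field_derivative_at_within\<close>)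
  moreover have "L * norm (t - t') \<le> L * dist p p'" "L * norm (x - x') \<le> L * dist p p'"
    using dist_fst_le[of p p'] dist_snd_le[of p p'] L
    by (auto intro!: mult_left_mono simp: tx tx' dist_norm)
  ultimately show "dist (case p of (t, x) \<Rightarrow> \<psi> t x) (case p' of (t, x) \<Rightarrow> \<psi> t x) \<le> 2 * L * dist p p'"
    by (auto simp: tx tx' dist_norm)
qed (use L in simp)

lemma deriv_zero_at_nonneg_root:
  fixes g :: "real \<Rightarrow> real"
  assumes "\<And>x. 0 \<le> g x" and "g y = 0" and "(g has_real_derivative d) (at y)"
  shows "d = 0"
  using DERIV_local_min[OF assms(3), of 1] assms(1,2) by auto

text \<open>
  Position on the circle measured from the base point \<open>b\<close> in the direction \<open>\<sigma> = \<plusminus>1\<close>.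
\<close>

definition arc_coord :: "real \<Rightarrow> real \<Rightarrow> real \<Rightarrow> real"
  where "arc_coord \<sigma> b x = frac (\<sigma> * (x - b))"

lemma arc_coord_bounds: "0 \<le> arc_coord \<sigma> b x" "arc_coord \<sigma> b x < 1"
  unfolding arc_coord_def by (auto simp: frac_lt_1)

lemma arc_coord_plus_one:
  assumes "\<sigma> \<in> {1, -1}"
  shows "arc_coord \<sigma> b (x + 1) = arc_coord \<sigma> b x"
proof (cases "\<sigma> = 1")
  case True
  then show ?thesis unfolding arc_coord_def using frac_1_eq[of "x - b"] by (simp add: algebra_simps)
next
  case False
  then have "\<sigma> = -1" using assms by auto
  then show ?thesis unfolding arc_coord_def using frac_1_eq[of "b - x - 1"] by (simp add: algebra_simps)
qed

text \<open>
  Near \<open>x\<close> with \<open>n = \<lfloor>x\<rfloor>\<close>, the composition with \<open>frac\<close> is the sum of the translates by \<open>n\<close> and \<open>n - 1\<close>.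
  The second one contributes no derivative at \<open>x\<close>, since a nonnegative function is critical at its zeros.
\<close>

lemma periodization_has_deriv:
  fixes g g' :: "real \<Rightarrow> real"
  assumes g: "\<And>y. (g has_real_derivative g' y) (at y)"
    and supp: "\<And>y. y \<notin> {0<..<1} \<Longrightarrow> g y = 0" and nonneg: "\<And>y. 0 \<le> g y"
  shows "((\<lambda>x. g (frac x)) has_real_derivative g' (frac x)) (at x)"
proof -
  define n :: real where "n = of_int \<lfloor>x\<rfloor>"
  have x: "n \<le> x" "x < n + 1" unfolding n_def by linarith+
  have g'0: "g' (x - n + 1) = 0"
    using deriv_zero_at_nonneg_root[OF nonneg supp g] x by auto
  have "((\<lambda>z. g (z - n) + g (z - n + 1)) has_real_derivative g' (x - n)) (at x)"
  proof -
    have "((\<lambda>z. g (z - n)) has_real_derivative g' (x - n) * 1) (at x)"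
      by (rule DERIV_chain2[OF g]) (auto intro!: derivative_eq_intros)
    moreover have "((\<lambda>z. g (z - n + 1)) has_real_derivative g' (x - n + 1) * 1) (at x)"
      by (rule DERIV_chain2[OF g]) (auto intro!: derivative_eq_intros)
    ultimately show ?thesis using g'0 DERIV_add by fastforce
  qed
  then have "((\<lambda>z. g (frac z)) has_real_derivative g' (x - n)) (at x)"
  proof (rule has_field_derivative_transform_within_open[where S="{n - 1<..<n + 1}"])
    fix z assume z: "z \<in> {n - 1<..<n + 1}"
    show "g (z - n) + g (z - n + 1) = g (frac z)"
    proof (cases "n \<le> z")
      case True
      then have "\<lfloor>z\<rfloor> = \<lfloor>x\<rfloor>" using z unfolding n_def by (intro floor_unique) auto
      then show ?thesis using supp[of "z - n + 1"] True unfolding frac_def n_def by simp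
    next
      case False
      then have "\<lfloor>z\<rfloor> = \<lfloor>x\<rfloor> - 1" using z unfolding n_def by (intro floor_unique) auto
      then have "frac z = z - n + 1" unfolding frac_def n_def by simp
      then show ?thesis using supp[of "z - n"] False by simp
    qed
  qed (use x in auto)
  then show ?thesis unfolding frac_def n_def .
qed

lemma arc_coord_has_deriv:
  fixes g g' :: "real \<Rightarrow> real"
  assumes g: "\<And>y. (g has_real_derivative g' y) (at y)"
    and supp: "\<And>y. y \<notin> {0<..<1} \<Longrightarrow> g y = 0" and nonneg: "\<And>y. 0 \<le> g y"
  shows "((\<lambda>x. g (arc_coord \<sigma> b x)) has_real_derivative \<sigma> * g' (arc_coord \<sigma> b x)) (at x)"
proof -
  have "((\<lambda>x. \<sigma> * (x - b)) has_real_derivative \<sigma>) (at x)"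
    by (auto intro!: derivative_eq_intros)
  from DERIV_chain2[OF periodization_has_deriv[OF assms] this]
  show ?thesis unfolding arc_coord_def by (simp add: mult.commute)
qed

text \<open>
  A function of time and of the position on the arc, cut off at both ends of \<open>(0, 1)\<close>, is an admissible
  test function on the circle; the direction \<open>\<sigma>\<close> enters only as the sign of the space derivative.
\<close>

lemma arc_test_function:
  fixes \<Psi> \<Psi>t \<Psi>y :: "real \<Rightarrow> real \<Rightarrow> real"
  assumes \<sigma>: "\<sigma> \<in> {1, -1}" and T: "0 \<le> T"
    and t: "\<And>t y. ((\<lambda>s. \<Psi> s y) has_real_derivative \<Psi>t t y) (at t)"
    and y: "\<And>t y. (\<Psi> t has_real_derivative \<Psi>y t y) (at y)"
    and cont: "continuous_on UNIV (\<lambda>(t, y). \<Psi>t t y)" "continuous_on UNIV (\<lambda>(t, y). \<Psi>y t y)"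
    and nonneg: "\<And>t y. t \<in> {0..T} \<Longrightarrow> 0 \<le> \<Psi> t y"
    and supp: "\<And>t y. y \<notin> {0<..<1} \<Longrightarrow> \<Psi> t y = 0"
    and final: "\<And>y. \<Psi> T y = 0"
  shows "lipschitz_test T (\<lambda>t x. \<Psi> t (arc_coord \<sigma> b x))"
    and "t \<in> {0..T} \<Longrightarrow> deriv (\<lambda>z. \<Psi> t (arc_coord \<sigma> b z)) x = \<sigma> * \<Psi>y t (arc_coord \<sigma> b x)"
    and "deriv (\<lambda>s. \<Psi> s (arc_coord \<sigma> b x)) t = \<Psi>t t (arc_coord \<sigma> b x)"
proof -
  have dx: "((\<lambda>z. \<Psi> t (arc_coord \<sigma> b z)) has_real_derivative \<sigma> * \<Psi>y t (arc_coord \<sigma> b x)) (at x)"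
    if "t \<in> {0..T}" for t x
    using arc_coord_has_deriv[of "\<Psi> t" "\<Psi>y t"] y supp nonneg[OF that] by blast
  then show "t \<in> {0..T} \<Longrightarrow> deriv (\<lambda>z. \<Psi> t (arc_coord \<sigma> b z)) x = \<sigma> * \<Psi>y t (arc_coord \<sigma> b x)"
    using DERIV_imp_deriv by blast
  show "deriv (\<lambda>s. \<Psi> s (arc_coord \<sigma> b x)) t = \<Psi>t t (arc_coord \<sigma> b x)"
    using DERIV_imp_deriv t by blast
  have "compact ({0..T} \<times> {0..1::real})" by (intro compact_Times) auto
  then have "bounded ((\<lambda>(t, y). \<Psi>t t y) ` ({0..T} \<times> {0..1}))" "bounded ((\<lambda>(t, y). \<Psi>y t y) ` ({0..T} \<times> {0..1}))"
    using cont by (meson compact_continuous_image compact_imp_bounded continuous_on_subset subset_UNIV)+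
  then obtain L1 L2 where L: "\<And>t y. t \<in> {0..T} \<Longrightarrow> y \<in> {0..1} \<Longrightarrow> \<bar>\<Psi>t t y\<bar> \<le> L1"
      "\<And>t y. t \<in> {0..T} \<Longrightarrow> y \<in> {0..1} \<Longrightarrow> \<bar>\<Psi>y t y\<bar> \<le> L2"
    unfolding bounded_real by fastforce
  define M where "M = max 0 (max L1 L2)"
  have co: "arc_coord \<sigma> b x \<in> {0..1}" for x using arc_coord_bounds[of \<sigma> b x] by auto
  have "(2 * M)-lipschitz_on ({0..T} \<times> UNIV) (\<lambda>(t, x). \<Psi> t (arc_coord \<sigma> b x))"
  proof (rule partial_derivatives_imp_lipschitz)
    show "((\<lambda>s. \<Psi> s (arc_coord \<sigma> b x)) has_real_derivative \<Psi>t t (arc_coord \<sigma> b x)) (at t)" for t x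
      by (rule t)
    show "\<bar>\<Psi>t t (arc_coord \<sigma> b x)\<bar> \<le> M" if "t \<in> {0..T}" for t x
      using L(1)[OF that co[of x]] unfolding M_def by auto
    show "\<bar>\<sigma> * \<Psi>y t (arc_coord \<sigma> b x)\<bar> \<le> M" if "t \<in> {0..T}" for t x
      using L(2)[OF that co[of x]] \<sigma> unfolding M_def by (auto simp: abs_mult)
  qed (use dx M_def in auto)
  moreover have "periodic_fun_simple' (\<lambda>x. \<Psi> t (arc_coord \<sigma> b x))" for t
    by unfold_locales (simp add: arc_coord_plus_one[OF \<sigma>])
  ultimately show "lipschitz_test T (\<lambda>t x. \<Psi> t (arc_coord \<sigma> b x))"
    unfolding lipschitz_test_def using nonneg final by blast
qed

section \<open>Power entropies\<close>

definition pos_entropy :: "real \<Rightarrow> real \<Rightarrow> nat \<Rightarrow> real \<Rightarrow> real"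
  where "pos_entropy \<tau> k n s = (max 0 (\<tau> * s - k)) ^ Suc (Suc n)"

lemma pos_entropy_has_deriv:
  "(pos_entropy \<tau> k n has_real_derivative \<tau> * (real (Suc (Suc n)) * (max 0 (\<tau> * s - k)) ^ Suc n)) (at s)"
proof -
  have "((\<lambda>s. \<tau> * s - k) has_real_derivative \<tau>) (at s)" by (auto intro!: derivative_eq_intros)
  from DERIV_chain2[OF pos_power_has_deriv this] show ?thesis
    unfolding pos_entropy_def by (simp add: mult.commute)
qed

lemma avg_deriv_eq:
  assumes "(\<eta> has_real_derivative d) (at s)"
  shows "avg_deriv \<eta> s = d"
proof -
  have "(\<eta> has_vector_derivative d) (at s within S)" for S
    using assms has_real_derivative_iff_has_vector_derivative has_vector_derivative_at_within by blast
  then have "vector_derivative \<eta> (at_left s) = d" "vector_derivative \<eta> (at_right s) = d"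
    by (auto intro!: vector_derivative_within simp: trivial_limit_at_left_real trivial_limit_at_right_real)
  then show ?thesis unfolding avg_deriv_def by simp
qed

lemmas avg_deriv_pos_entropy = avg_deriv_eq[OF pos_entropy_has_deriv]

lemma convex_pos_entropy:
  assumes "\<tau> \<in> {1, -1}"
  shows "convex_on UNIV (pos_entropy \<tau> k n)"
proof (rule convex_on_realI)
  show "(pos_entropy \<tau> k n has_real_derivative \<tau> * (real (Suc (Suc n)) * (max 0 (\<tau> * s - k)) ^ Suc n)) (at s)" for s
    by (rule pos_entropy_has_deriv)
  fix x y :: real assume "x \<le> y"
  then have "x \<le> y" .
  have pw: "(max 0 (x - k)) ^ Suc n \<le> (max 0 (y - k)) ^ Suc n" if "x \<le> y" for x y :: real
    using that by (intro power_mono) auto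
  show "\<tau> * (real (Suc (Suc n)) * (max 0 (\<tau> * x - k)) ^ Suc n) \<le> \<tau> * (real (Suc (Suc n)) * (max 0 (\<tau> * y - k)) ^ Suc n)"
  proof (cases "\<tau> = 1")
    case True
    then show ?thesis using pw[OF \<open>x \<le> y\<close>] by (auto intro!: mult_left_mono)
  next
    case False
    then have "\<tau> = -1" using assms by auto
    then show ?thesis using pw[of "-y" "-x"] \<open>x \<le> y\<close> by (auto intro!: mult_left_mono)
  qed
qed auto

text \<open>
  The flux is \<open>Q(\<tau> s)\<close> with \<open>Q v = \<integral>\<^sub>k\<^sup>v p (r - k)^(p - 1) f'(\<tau> r) dr\<close>, \<open>p = n + 2\<close>.  Up to the sign \<open>\<sigma>\<close>
  it is the entropy \<open>(v - k)^p\<close> times an average of the speed over \<open>[k, v]\<close>, which gives the two-sided bound.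
\<close>

lemma pos_entropy_flux:
  assumes cont: "continuous_on UNIV (deriv f)" and \<sigma>: "\<sigma> \<in> {1, -1}" and \<tau>: "\<tau> \<in> {1, -1}"
    and speed: "\<And>v. v \<in> {k..M} \<Longrightarrow> lo \<le> \<sigma> * deriv f (\<tau> * v) \<and> \<sigma> * deriv f (\<tau> * v) \<le> hi"
  obtains q where "entropy_flux f (pos_entropy \<tau> k n) q" "continuous_on UNIV q"
    "\<And>s. \<tau> * s \<le> k \<Longrightarrow> q s = 0"
    "\<And>s. k \<le> \<tau> * s \<Longrightarrow> \<tau> * s \<le> M \<Longrightarrow>
       lo * pos_entropy \<tau> k n s \<le> \<sigma> * q s \<and> \<sigma> * q s \<le> hi * pos_entropy \<tau> k n s"
proof -
  define e where "e v = real (Suc (Suc n)) * (max 0 (v - k)) ^ Suc n * deriv f (\<tau> * v)" for v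
  define G where "G v = integral {k..v} e" for v
  have conte: "continuous_on A e" for A
  proof -
    have "continuous_on UNIV (\<lambda>v. deriv f (\<tau> * v))"
      using continuous_on_compose2[OF cont, of UNIV "\<lambda>v. \<tau> * v"] by (auto intro!: continuous_intros)
    then have "continuous_on UNIV e" unfolding e_def by (intro continuous_intros)
    then show ?thesis using continuous_on_subset by blast
  qed
  have G0: "G v = 0" if "v \<le> k" for v
    using that unfolding G_def by (cases "v = k") auto
  have Gd: "(G has_real_derivative e v) (at v)" for v
  proof -
    define l h where "l = min v k - 1" and "h = max v k + 1"
    have int: "e integrable_on {a..b}" for a b
      using conte by (rule integrable_continuous_real)
    \<comment> \<open>The integrand vanishes below \<open>k\<close>, so moving the lower limit from \<open>k\<close> to any \<open>l \<le> k\<close> changes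
      nothing; a lower limit below \<open>v\<close> makes the fundamental theorem applicable at \<open>v\<close>.\<close>
    have eq: "integral {l..z} e = G z" if "z \<in> {l..h}" for z
    proof (cases "z \<le> k")
      case True
      have "integral {l..z} e = integral {l..z} (\<lambda>_. 0)"
        by (rule integral_cong) (use True in \<open>auto simp: e_def\<close>)
      then show ?thesis using G0[OF True] by simp
    next
      case False
      have "integral {l..k} e = integral {l..k} (\<lambda>_. 0)"
        by (rule integral_cong) (auto simp: e_def)
      then show ?thesis
        using Henstock_Kurzweil_Integration.integral_combine[where a=l and c=k and b=z and f=e] False int that unfolding G_def l_def by auto
    qed
    have "((\<lambda>z. integral {l..z} e) has_real_derivative e v) (at v within {l..h})"
      by (rule integral_has_real_derivative[OF conte]) (auto simp: l_def h_def)
    then have "(G has_real_derivative e v) (at v within {l..h})"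
      by (rule has_field_derivative_transform_within[where d=1]) (use eq in \<open>auto simp: l_def h_def\<close>)
    moreover have "at v within {l..h} = at v"
      by (rule at_within_interior) (auto simp: l_def h_def)
    ultimately show ?thesis by simp
  qed
  define q where "q s = G (\<tau> * s)" for s
  have qd: "(q has_real_derivative deriv f s * avg_deriv (pos_entropy \<tau> k n) s) (at s)" for s
  proof -
    have "((\<lambda>s. \<tau> * s) has_real_derivative \<tau>) (at s)" by (auto intro!: derivative_eq_intros)
    from DERIV_chain2[OF Gd this]
    have "(q has_real_derivative e (\<tau> * s) * \<tau>) (at s)" unfolding q_def by simp
    moreover have "\<tau> * (\<tau> * s) = s" using \<tau> by auto
    ultimately show ?thesis unfolding avg_deriv_pos_entropy e_def by (simp add: mult.commute mult.left_commute)
  qed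
  have flux: "entropy_flux f (pos_entropy \<tau> k n) q"
    unfolding entropy_flux_def
    by (intro allI impI fundamental_theorem_of_calculus)
      (auto simp flip: has_real_derivative_iff_has_vector_derivative intro: has_field_derivative_at_within qd)
  have contq: "continuous_on UNIV q"
    using qd DERIV_continuous continuous_at_imp_continuous_on by blast
  have P: "((\<lambda>v. (max 0 (v - k)) ^ Suc (Suc n)) has_real_derivative
      real (Suc (Suc n)) * (max 0 (v - k)) ^ Suc n) (at v)" for v
    using pos_entropy_has_deriv[of 1 k n v] unfolding pos_entropy_def by simp
  have bounds: "lo * (max 0 (v - k)) ^ Suc (Suc n) \<le> \<sigma> * G v \<and> \<sigma> * G v \<le> hi * (max 0 (v - k)) ^ Suc (Suc n)"
    if v: "k \<le> v" "v \<le> M" for v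
  proof
    have "\<sigma> * G k - lo * (max 0 (k - k)) ^ Suc (Suc n) \<le> \<sigma> * G v - lo * (max 0 (v - k)) ^ Suc (Suc n)"
    proof (rule DERIV_nonneg_imp_nondecreasing[OF v(1)])
      fix z assume z: "k \<le> z" "z \<le> v"
      have "((\<lambda>v. \<sigma> * G v - lo * (max 0 (v - k)) ^ Suc (Suc n)) has_real_derivative
          \<sigma> * e z - lo * (real (Suc (Suc n)) * (max 0 (z - k)) ^ Suc n)) (at z)"
        by (intro DERIV_diff DERIV_cmult Gd P)
      moreover have "\<sigma> * e z - lo * (real (Suc (Suc n)) * (max 0 (z - k)) ^ Suc n)
          = real (Suc (Suc n)) * (max 0 (z - k)) ^ Suc n * (\<sigma> * deriv f (\<tau> * z) - lo)"
        unfolding e_def by (simp add: algebra_simps)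
      moreover have "\<dots> \<ge> 0" using speed[of z] z v by (intro mult_nonneg_nonneg) auto
      ultimately show "\<exists>y. ((\<lambda>v. \<sigma> * G v - lo * (max 0 (v - k)) ^ Suc (Suc n)) has_real_derivative y) (at z) \<and> 0 \<le> y"
        by metis
    qed
    then show "lo * (max 0 (v - k)) ^ Suc (Suc n) \<le> \<sigma> * G v" using G0[of k] by simp
    have "hi * (max 0 (k - k)) ^ Suc (Suc n) - \<sigma> * G k \<le> hi * (max 0 (v - k)) ^ Suc (Suc n) - \<sigma> * G v"
    proof (rule DERIV_nonneg_imp_nondecreasing[OF v(1)])
      fix z assume z: "k \<le> z" "z \<le> v"
      have "((\<lambda>v. hi * (max 0 (v - k)) ^ Suc (Suc n) - \<sigma> * G v) has_real_derivative
          hi * (real (Suc (Suc n)) * (max 0 (z - k)) ^ Suc n) - \<sigma> * e z) (at z)"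
        by (intro DERIV_diff DERIV_cmult Gd P)
      moreover have "hi * (real (Suc (Suc n)) * (max 0 (z - k)) ^ Suc n) - \<sigma> * e z
          = real (Suc (Suc n)) * (max 0 (z - k)) ^ Suc n * (hi - \<sigma> * deriv f (\<tau> * z))"
        unfolding e_def by (simp add: algebra_simps)
      moreover have "\<dots> \<ge> 0" using speed[of z] z v by (intro mult_nonneg_nonneg) auto
      ultimately show "\<exists>y. ((\<lambda>v. hi * (max 0 (v - k)) ^ Suc (Suc n) - \<sigma> * G v) has_real_derivative y) (at z) \<and> 0 \<le> y"
        by metis
    qed
    then show "\<sigma> * G v \<le> hi * (max 0 (v - k)) ^ Suc (Suc n)" using G0[of k] by simp
  qed
  show ?thesis
    by (rule that[OF flux contq]) (use G0 bounds in \<open>auto simp: q_def pos_entropy_def\<close>)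
qed

section \<open>Null sets and measurability on the space-time strip\<close>

lemma AE_strip_iff:
  "(AE z in strip T. P z) \<longleftrightarrow> (AE z in lborel \<Otimes>\<^sub>M lborel. z \<in> {0..T} \<times> {0..<1} \<longrightarrow> P z)"
proof -
  have "{0..T} \<times> {0..<1::real} \<in> sets lebesgue"
    using borel_Times[of "{0..T}" "{0..<1::real}"] by (intro sets_completionI_sets) auto
  then have "(AE z in strip T. P z) \<longleftrightarrow> (AE z in lebesgue. z \<in> {0..T} \<times> {0..<1} \<longrightarrow> P z)"
    by (subst AE_restrict_space_iff) auto
  then show ?thesis unfolding AE_completion_iff lborel_prod .
qed

lemma AE_circ_iff: "(AE x in circ. P x) \<longleftrightarrow> (AE x in lborel. x \<in> {0..<1} \<longrightarrow> P x)"
  by (subst AE_restrict_space_iff) (auto simp: AE_completion_iff)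

lemma AE_lborel_snd:
  assumes "AE x in lborel. P (x::real)"
  shows "AE z in lborel \<Otimes>\<^sub>M (lborel :: real measure). P (snd (z :: real \<times> real))"
proof -
  obtain N where N: "N \<in> null_sets lborel" "{x. \<not> P x} \<subseteq> N"
    using assms unfolding eventually_ae_filter by auto
  have "UNIV \<times> N \<in> null_sets (lborel \<Otimes>\<^sub>M (lborel :: real measure))"
    using N(1) by (auto simp: null_sets_def lborel.emeasure_pair_measure_Times)
  then show ?thesis by (rule AE_I') (use N(2) in auto)
qed

lemma AE_strip_of_circ:
  assumes "AE x in circ. P x"
  shows "AE z in strip T. P (snd z)"
  using AE_lborel_snd[of "\<lambda>x. x \<in> {0..<1} \<longrightarrow> P x"] assms
  unfolding AE_strip_iff AE_circ_iff by (auto elim!: eventually_mono)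

lemma AE_strip_slice:
  assumes "AE z in strip T. P z"
  shows "AE t in lborel. t \<in> {0..T} \<longrightarrow> (AE x in circ. P (t, x))"
  using lborel_pair.AE_pair[OF assms[unfolded AE_strip_iff]]
  unfolding AE_circ_iff by (auto elim!: eventually_mono)

text \<open>
  For completed measures, composition with a projection does not obviously preserve measurability.  The
  function is therefore replaced by a Borel function that agrees with it outside a null set, and the null
  set is lifted to the strip.
\<close>

lemma measurable_snd_strip:
  fixes g :: "real \<Rightarrow> real"
  assumes g: "g \<in> borel_measurable circ"
  shows "(\<lambda>z. g (snd z)) \<in> borel_measurable (strip T)"
proof -
  define g0 where "g0 x = (if x \<in> {0..<1} then g x else 0)" for x
  have "g0 \<in> borel_measurable lebesgue"
    unfolding g0_def using g by (rule borel_measurable_if_I) simp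
  then obtain g' where g': "g' \<in> borel_measurable lborel" "AE x in lborel. g0 x = g' x"
    using completion_ex_borel_measurable_real by blast
  have "(\<lambda>z::real \<times> real. g' (snd z)) \<in> borel_measurable lebesgue"
    using g'(1) by (intro measurable_completion) (simp add: borel_prod[symmetric])
  moreover have "AE z in lebesgue. g' (snd z) = g0 (snd (z :: real \<times> real))"
    unfolding AE_completion_iff
    using AE_lborel_snd[OF g'(2)] unfolding lborel_prod by (auto elim!: eventually_mono)
  ultimately have "(\<lambda>z::real \<times> real. g0 (snd z)) \<in> borel_measurable lebesgue"
    by (rule borel_measurable_AE)
  then have "(\<lambda>z. g0 (snd z)) \<in> borel_measurable (strip T)"
    by (rule measurable_restrict_space1)
  then show ?thesis
    by (rule measurable_cong[THEN iffD1, rotated]) (auto simp: g0_def space_restrict_space)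
qed

lemma borel_measurable_strip:
  "g \<in> borel_measurable borel \<Longrightarrow> g \<in> borel_measurable (strip T)"
  by (intro measurable_restrict_space1 measurable_completion) simp

lemma strip_finite: "finite_measure (strip T)"
proof (rule finite_measure_lebesgue_on, rule bounded_set_imp_lmeasurable)
  show "{0..T} \<times> {0..<1::real} \<in> sets lebesgue"
    using borel_Times[of "{0..T}" "{0..<1::real}"] by (intro sets_completionI_sets) auto
qed (auto intro!: bounded_Times)

lemma AE_real_bound:
  assumes "esssup M (\<lambda>x. ereal \<bar>g x\<bar>) < \<infinity>"
  obtains C where "0 \<le> C" "AE x in M. \<bar>g x\<bar> \<le> C"
proof -
  obtain C where "esssup M (\<lambda>x. ereal \<bar>g x\<bar>) \<le> ereal C" 
    using assms by (cases "esssup M (\<lambda>x. ereal \<bar>g x\<bar>)") auto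
  then have "AE x in M. ereal \<bar>g x\<bar> \<le> ereal C"
    using esssup_AE[of "\<lambda>x. ereal \<bar>g x\<bar>" M] by (elim eventually_mono) (rule order_trans)
  then have "AE x in M. \<bar>g x\<bar> \<le> max 0 C" by (auto elim!: eventually_mono)
  then show ?thesis using that[of "max 0 C"] by auto
qed

text \<open>
  A common form of the two notions of solution, for \<open>\<alpha> < 1\<close> and for \<open>\<alpha> = 1\<close>: a bounded source term
  that damps at least at the rate \<open>a \<bar>u\<bar> powr (1 - \<alpha>)\<close>; for \<open>\<alpha> = 1\<close> this rate is \<open>a\<close>, because \<open>Sign u\<close> is a singleton for \<open>u \<noteq> 0\<close>.
\<close>

lemma admissible_solution_damping:
  assumes \<alpha>: "\<alpha> \<in> {0<..1}" and a: "condition_A a"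
    and u: "admissible_weak_solution \<alpha> f a T u0 u"
  obtains h C where "(\<lambda>z. h (fst z) (snd z)) \<in> borel_measurable (strip T)"
    "AE z in strip T. \<bar>h (fst z) (snd z)\<bar> \<le> C"
    "entropy_inequality f T u0 u h"
    "AE z in strip T. \<forall>\<tau>\<in>{1,-1}. 0 < \<tau> * u (fst z) (snd z) \<longrightarrow>
       a (snd z) * (\<tau> * u (fst z) (snd z)) powr (1 - \<alpha>) \<le> \<tau> * h (fst z) (snd z)"
proof (cases "\<alpha> < 1")
  case True
  define h where "h t x = a x * (u t x / \<bar>u t x\<bar> powr \<alpha>)" for t x
  have bm: "bounded_measurable T u" and ent: "entropy_inequality f T u0 u h"
    using u True unfolding admissible_weak_solution_def h_def by auto
  have am: "a \<in> borel_measurable circ" and a0: "\<And>x. 0 \<le> a x"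
    using a unfolding condition_A_def Linfty_def by auto
  obtain Ca where Ca: "0 \<le> Ca" "AE x in circ. \<bar>a x\<bar> \<le> Ca"
    using a AE_real_bound[of circ a] unfolding condition_A_def Linfty_def Linfty_norm_def by blast
  have "(\<lambda>z. u (fst z) (snd z)) \<in> borel_measurable (strip T)"
    using bm unfolding bounded_measurable_def by (simp add: case_prod_unfold)
  with measurable_snd_strip[OF am]
  have hm: "(\<lambda>z. h (fst z) (snd z)) \<in> borel_measurable (strip T)"
    unfolding h_def by measurable
  obtain B where B: "\<And>t x. t \<in> {0..T} \<Longrightarrow> \<bar>u t x\<bar> \<le> B"
    using bm unfolding bounded_measurable_def bounded_real by fastforce
  have ratio: "\<bar>s\<bar> / \<bar>s\<bar> powr \<alpha> = \<bar>s\<bar> powr (1 - \<alpha>)" if "s \<noteq> 0" for s :: real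
    using that powr_diff[of "\<bar>s\<bar>" 1 \<alpha>] by simp
  have rat_le: "\<bar>s / \<bar>s\<bar> powr \<alpha>\<bar> \<le> B powr (1 - \<alpha>)" if "\<bar>s\<bar> \<le> B" for s
  proof (cases "s = 0")
    case False
    have "\<bar>s / \<bar>s\<bar> powr \<alpha>\<bar> = \<bar>s\<bar> powr (1 - \<alpha>)" using ratio[OF False] by simp
    also have "\<dots> \<le> B powr (1 - \<alpha>)" using that True by (intro powr_mono2) auto
    finally show ?thesis .
  qed simp
  have hb: "AE z in strip T. \<bar>h (fst z) (snd z)\<bar> \<le> Ca * B powr (1 - \<alpha>)"
    using AE_strip_of_circ[OF Ca(2)] AE_space
  proof eventually_elim
    case (elim z)
    then have "\<bar>u (fst z) (snd z)\<bar> \<le> B" using B by (auto simp: space_restrict_space)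
    then show ?case unfolding h_def abs_mult using elim Ca(1) rat_le
      by (intro mult_mono) (auto simp: abs_mult)
  qed
  have "AE z in strip T. \<forall>\<tau>\<in>{1,-1}. 0 < \<tau> * u (fst z) (snd z) \<longrightarrow>
       a (snd z) * (\<tau> * u (fst z) (snd z)) powr (1 - \<alpha>) \<le> \<tau> * h (fst z) (snd z)"
  proof (intro AE_I2 ballI impI)
    fix z and \<tau> :: real assume \<tau>: "\<tau> \<in> {1,-1}" and pos: "0 < \<tau> * u (fst z) (snd z)"
    have "\<tau> * u (fst z) (snd z) = \<bar>u (fst z) (snd z)\<bar>" "u (fst z) (snd z) \<noteq> 0"
      using \<tau> pos by auto
    then have "a (snd z) * (\<tau> * u (fst z) (snd z)) powr (1 - \<alpha>)
        = a (snd z) * (\<tau> * u (fst z) (snd z) / \<bar>u (fst z) (snd z)\<bar> powr \<alpha>)"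
      using ratio by simp
    then show "a (snd z) * (\<tau> * u (fst z) (snd z)) powr (1 - \<alpha>) \<le> \<tau> * h (fst z) (snd z)"
      unfolding h_def by (simp add: mult.left_commute)
  qed
  then show ?thesis using that hm hb ent by blast
next
  case False
  then have \<alpha>1: "\<alpha> = 1" using \<alpha> by auto
  obtain h where h: "Linfty_strip T h" "entropy_inequality f T u0 u h"
    "AE (t, x) in strip T. h t x \<in> (\<lambda>s. a x * s) ` Sign (u t x)"
    using u False unfolding admissible_weak_solution_def by auto
  have hm: "(\<lambda>z. h (fst z) (snd z)) \<in> borel_measurable (strip T)"
    using h(1) unfolding Linfty_strip_def by (simp add: case_prod_unfold)
  obtain C where C: "AE z in strip T. \<bar>h (fst z) (snd z)\<bar> \<le> C"
    using h(1) AE_real_bound[of "strip T" "\<lambda>z. h (fst z) (snd z)"]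
    unfolding Linfty_strip_def by (auto simp: case_prod_unfold)
  have "AE z in strip T. \<forall>\<tau>\<in>{1,-1}. 0 < \<tau> * u (fst z) (snd z) \<longrightarrow>
       a (snd z) * (\<tau> * u (fst z) (snd z)) powr (1 - \<alpha>) \<le> \<tau> * h (fst z) (snd z)"
    using h(3) by eventually_elim (auto simp: Sign_def \<alpha>1 split: if_splits)
  then show ?thesis using that hm C h(2) by blast
qed

section \<open>Comparison with barriers\<close>

text \<open>
  Letting \<open>p \<rightarrow> \<infinity>\<close>: on a set of positive measure where \<open>\<theta> \<ge> \<epsilon>\<close> and \<open>E \<ge> 1 + \<epsilon>\<close>, the integral of
  \<open>\<theta> E^p\<close> would grow exponentially in \<open>p\<close>.
\<close>

lemma uniform_power_bound_imp_le_one: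
  fixes \<theta> E :: "'a \<Rightarrow> real"
  assumes fin: "finite_measure M"
    and meas: "\<theta> \<in> borel_measurable M" "E \<in> borel_measurable M"
    and nonneg: "\<And>x. 0 \<le> \<theta> x" "\<And>x. 0 \<le> E x"
    and int: "\<And>n. integrable M (\<lambda>x. \<theta> x * E x ^ Suc (Suc n))"
    and bound: "\<And>n. (\<integral>x. \<theta> x * E x ^ Suc (Suc n) \<partial>M) \<le> C"
  shows "AE x in M. 0 < \<theta> x \<longrightarrow> E x \<le> 1"
proof -
  interpret finite_measure M by fact
  have null: "AE x in M. \<not> (\<epsilon> \<le> \<theta> x \<and> 1 + \<epsilon> \<le> E x)" if \<epsilon>: "0 < \<epsilon>" for \<epsilon> :: real
  proof -
    define A where "A = {x \<in> space M. \<epsilon> \<le> \<theta> x \<and> 1 + \<epsilon> \<le> E x}"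
    have A: "A \<in> sets M" unfolding A_def using meas by measurable
    have le: "\<epsilon> * (1 + \<epsilon>) ^ Suc (Suc n) * measure M A \<le> C" for n
    proof -
      have "(\<integral>x. \<epsilon> * (1 + \<epsilon>) ^ Suc (Suc n) * indicator A x \<partial>M) \<le> (\<integral>x. \<theta> x * E x ^ Suc (Suc n) \<partial>M)"
      proof (rule integral_mono[OF _ int])
        fix x
        show "\<epsilon> * (1 + \<epsilon>) ^ Suc (Suc n) * indicator A x \<le> \<theta> x * E x ^ Suc (Suc n)"
        proof (cases "x \<in> A")
          case True
          then have "\<epsilon> \<le> \<theta> x" "(1 + \<epsilon>) ^ Suc (Suc n) \<le> E x ^ Suc (Suc n)"
            using \<epsilon> by (auto simp: A_def simp del: power_Suc intro!: power_mono)
          then show ?thesis using True \<epsilon> by (auto simp del: power_Suc intro!: mult_mono)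
        qed (use nonneg in auto)
      qed (use A in \<open>auto simp: emeasure_finite less_top[symmetric]\<close>)
      also have "\<dots> \<le> C" by (rule bound)
      finally show ?thesis using A by (simp add: mult.commute)
    qed
    have "measure M A = 0"
    proof (rule ccontr)
      assume "measure M A \<noteq> 0"
      then have pos: "0 < \<epsilon> * measure M A" using \<epsilon> by (simp add: zero_less_measure_iff)
      obtain n where n: "C / (\<epsilon> * measure M A) < (1 + \<epsilon>) ^ n"
        using real_arch_pow[of "1 + \<epsilon>"] \<epsilon> by auto
      have "(1 + \<epsilon>) ^ n \<le> (1 + \<epsilon>) ^ Suc (Suc n)" using \<epsilon> by (intro power_increasing) auto
      with n have "C / (\<epsilon> * measure M A) < (1 + \<epsilon>) ^ Suc (Suc n)" by linarith
      then have "C < \<epsilon> * (1 + \<epsilon>) ^ Suc (Suc n) * measure M A"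
        using pos by (simp add: pos_divide_less_eq mult_ac del: power_Suc)
      then show False using le[of n] by linarith
    qed
    then have "A \<in> null_sets M" using A by (simp add: null_sets_def emeasure_eq_measure)
    from AE_not_in[OF this] show ?thesis using AE_space by eventually_elim (auto simp: A_def)
  qed
  then have "AE x in M. \<forall>n. \<not> (1 / real (Suc n) \<le> \<theta> x \<and> 1 + 1 / real (Suc n) \<le> E x)"
    by (intro AE_all_countable[THEN iffD2] allI null) simp
  then show ?thesis
  proof eventually_elim
    case (elim x)
    show ?case
    proof (rule impI, rule ccontr)
      assume \<theta>: "0 < \<theta> x" and "\<not> E x \<le> 1"
      then have "0 < min (\<theta> x) (E x - 1)" by auto
      then obtain n where "inverse (real (Suc n)) < min (\<theta> x) (E x - 1)"
        using reals_Archimedean by blast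
      then show False using elim by (auto simp: inverse_eq_divide dest!: spec[of _ n])
    qed
  qed
qed

text \<open>
  The positive part of \<open>U = \<tau> u\<close> moves in the direction \<open>\<sigma>\<close>.  The four combinations of \<open>\<sigma>\<close> and \<open>\<tau>\<close>
  cover convex and concave fluxes and both signs of the solution, so each estimate is proved once.
\<close>

locale one_sided_solution =
  fixes \<alpha> K :: real and f a u0 :: "real \<Rightarrow> real" and u :: "real \<Rightarrow> real \<Rightarrow> real" and \<sigma> \<tau> c0 c1 :: real
  assumes \<alpha>: "\<alpha> \<in> {0<..1}" and K: "0 < K"
    and \<sigma>: "\<sigma> \<in> {1, -1}" and \<tau>: "\<tau> \<in> {1, -1}"
    and f'_cont: "continuous_on UNIV (deriv f)"
    and speed_mono': "\<And>v v'. 0 \<le> v \<Longrightarrow> v \<le> v' \<Longrightarrow> v' \<le> K \<Longrightarrow> \<sigma> * deriv f (\<tau> * v) \<le> \<sigma> * deriv f (\<tau> * v')"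
    and speed_bounds': "\<And>v. 0 \<le> v \<Longrightarrow> v \<le> K \<Longrightarrow> c0 * v \<le> \<sigma> * deriv f (\<tau> * v) \<and> \<sigma> * deriv f (\<tau> * v) \<le> c1 * v"
    and c0: "0 < c0"
    and a: "condition_A a"
    and sol: "\<And>T. 0 < T \<Longrightarrow> admissible_weak_solution \<alpha> f a T u0 u"
    and u0_le: "AE x in circ. \<tau> * u0 x \<le> K"
begin

definition speed :: "real \<Rightarrow> real"
  where "speed v = \<sigma> * deriv f (\<tau> * v)"

definition U :: "real \<times> real \<Rightarrow> real"
  where "U z = \<tau> * u (fst z) (snd z)"

lemmas speed_mono = speed_mono'[folded speed_def]
lemmas speed_lower = speed_bounds'[folded speed_def, THEN conjunct1]
lemmas speed_upper = speed_bounds'[folded speed_def, THEN conjunct2]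

lemma a_nonneg: "0 \<le> a x"
  using a unfolding condition_A_def by auto

lemma U_measurable:
  assumes "0 < T" shows "U \<in> borel_measurable (strip T)"
proof -
  have "(\<lambda>z. u (fst z) (snd z)) \<in> borel_measurable (strip T)"
    using sol[OF assms] unfolding admissible_weak_solution_def bounded_measurable_def
    by (simp add: case_prod_unfold)
  then show ?thesis unfolding U_def by measurable
qed

lemma u_bounded:
  assumes "0 < T"
  obtains B where "0 \<le> B" "\<And>t x. t \<in> {0..T} \<Longrightarrow> \<bar>u t x\<bar> \<le> B"
proof -
  obtain B where "\<And>t x. t \<in> {0..T} \<Longrightarrow> \<bar>u t x\<bar> \<le> B"
    using sol[OF assms] unfolding admissible_weak_solution_def bounded_measurable_def bounded_real
    by fastforce
  then show ?thesis
    by (intro that[of "max 0 B"]) (auto intro: max.coboundedI2)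
qed

text \<open>
  The entropy inequality in the form in which it is used: the unknown flux and source are replaced by
  an arbitrary speed \<open>c \<in> [lo, hi]\<close> and an arbitrary damping \<open>H\<close> above the guaranteed rate.  If the
  integrand is at most \<open>G\<close> for all of them, then \<open>G\<close> has a nonnegative integral.
\<close>

lemma entropy_bound:
  assumes T: "0 < T" and k: "0 \<le> k"
    and test: "lipschitz_test T \<psi>"
    and dt: "\<And>t x. t \<in> {0..T} \<Longrightarrow> deriv (\<lambda>s. \<psi> s x) t = \<psi>t t x"
    and dx: "\<And>t x. t \<in> {0..T} \<Longrightarrow> deriv (\<psi> t) x = \<sigma> * \<psi>x t x"
    and meas: "(\<lambda>z. \<psi> (fst z) (snd z)) \<in> borel_measurable (strip T)"
      "(\<lambda>z. \<psi>t (fst z) (snd z)) \<in> borel_measurable (strip T)"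
      "(\<lambda>z. \<psi>x (fst z) (snd z)) \<in> borel_measurable (strip T)"
    and bd: "\<And>t x. t \<in> {0..T} \<Longrightarrow> \<bar>\<psi> t x\<bar> \<le> L \<and> \<bar>\<psi>t t x\<bar> \<le> L \<and> \<bar>\<psi>x t x\<bar> \<le> L"
    and init: "AE x in circ. \<psi> 0 x = 0 \<or> \<tau> * u0 x \<le> k"
    and speeds: "\<And>v. v \<in> {k..M} \<Longrightarrow> lo \<le> speed v \<and> speed v \<le> hi" "lo \<le> hi"
    and le_M: "AE z in strip T. \<psi>x (fst z) (snd z) \<noteq> 0 \<longrightarrow> U z \<le> M"
    and pw: "AE z in strip T. \<forall>c H. lo \<le> c \<longrightarrow> c \<le> hi \<longrightarrow>
        (0 < U z \<longrightarrow> a (snd z) * U z powr (1 - \<alpha>) \<le> H) \<longrightarrow>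
        (\<psi>t (fst z) (snd z) + c * \<psi>x (fst z) (snd z)) * (max 0 (U z - k)) ^ Suc (Suc n)
        - \<psi> (fst z) (snd z) * (real (Suc (Suc n)) * (max 0 (U z - k)) ^ Suc n) * H \<le> G z"
    and G: "integrable (strip T) G"
  shows "0 \<le> (\<integral>z. G z \<partial>strip T)"
proof -
  interpret finite_measure "strip T" by (rule strip_finite)
  obtain h C where h: "(\<lambda>z. h (fst z) (snd z)) \<in> borel_measurable (strip T)"
    "AE z in strip T. \<bar>h (fst z) (snd z)\<bar> \<le> C"
    "entropy_inequality f T u0 u h"
    "AE z in strip T. \<forall>\<tau>\<in>{1,-1}. 0 < \<tau> * u (fst z) (snd z) \<longrightarrow>
       a (snd z) * (\<tau> * u (fst z) (snd z)) powr (1 - \<alpha>) \<le> \<tau> * h (fst z) (snd z)"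
    by (rule admissible_solution_damping[OF \<alpha> a sol[OF T]])
  let ?\<eta> = "pos_entropy \<tau> k n"
  have sp: "lo \<le> \<sigma> * deriv f (\<tau> * v) \<and> \<sigma> * deriv f (\<tau> * v) \<le> hi" if "v \<in> {k..M}" for v
    using speeds(1)[OF that] unfolding speed_def .
  obtain q where q: "entropy_flux f ?\<eta> q" "continuous_on UNIV q"
    "\<And>s. \<tau> * s \<le> k \<Longrightarrow> q s = 0"
    "\<And>s. k \<le> \<tau> * s \<Longrightarrow> \<tau> * s \<le> M \<Longrightarrow>
       lo * ?\<eta> s \<le> \<sigma> * q s \<and> \<sigma> * q s \<le> hi * ?\<eta> s"
    by (rule pos_entropy_flux[where k=k and M=M and lo=lo and hi=hi and n=n, OF f'_cont \<sigma> \<tau> sp], assumption, rule that)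
  obtain B where B: "0 \<le> B" "\<And>t x. t \<in> {0..T} \<Longrightarrow> \<bar>u t x\<bar> \<le> B" by (rule u_bounded[OF T]) (rule that, assumption+)
  define \<eta>' where "\<eta>' s = \<tau> * (real (Suc (Suc n)) * (max 0 (\<tau> * s - k)) ^ Suc n)" for s
  have cont: "continuous_on UNIV ?\<eta>" "continuous_on UNIV \<eta>'"
    unfolding pos_entropy_def \<eta>'_def by (auto intro!: continuous_intros simp del: power_Suc)
  have bdd: "\<exists>D\<ge>0. \<forall>s\<in>{-B..B}. \<bar>g s\<bar> \<le> D" if "continuous_on UNIV g" for g :: "real \<Rightarrow> real"
  proof -
    have "bounded (g ` {-B..B})"
      using that by (meson compact_Icc compact_continuous_image compact_imp_bounded continuous_on_subset subset_UNIV)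
    then obtain D where "\<forall>s\<in>{-B..B}. \<bar>g s\<bar> \<le> D" unfolding bounded_real by blast
    then show ?thesis by (intro exI[of _ "max 0 D"]) fastforce
  qed
  obtain D1 where D1: "0 \<le> D1" "\<And>s. \<bar>s\<bar> \<le> B \<Longrightarrow> \<bar>?\<eta> s\<bar> \<le> D1" using bdd[OF cont(1)] by (auto simp: abs_le_iff)
  obtain D2 where D2: "0 \<le> D2" "\<And>s. \<bar>s\<bar> \<le> B \<Longrightarrow> \<bar>\<eta>' s\<bar> \<le> D2" using bdd[OF cont(2)] by (auto simp: abs_le_iff)
  obtain D3 where D3: "0 \<le> D3" "\<And>s. \<bar>s\<bar> \<le> B \<Longrightarrow> \<bar>q s\<bar> \<le> D3" using bdd[OF q(2)] by (auto simp: abs_le_iff)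
  define J where "J z = \<psi>t (fst z) (snd z) * ?\<eta> (u (fst z) (snd z))
      + \<sigma> * \<psi>x (fst z) (snd z) * q (u (fst z) (snd z))
      - \<psi> (fst z) (snd z) * \<eta>' (u (fst z) (snd z)) * h (fst z) (snd z)" for z
  have um: "(\<lambda>z. u (fst z) (snd z)) \<in> borel_measurable (strip T)"
  proof -
    have "(\<lambda>z. \<tau> * U z) \<in> borel_measurable (strip T)" using U_measurable[OF T] by measurable
    moreover have "(\<lambda>z. \<tau> * U z) = (\<lambda>z. u (fst z) (snd z))" using \<tau> unfolding U_def by auto
    ultimately show ?thesis by simp
  qed
  have comp: "(\<lambda>z. g (u (fst z) (snd z))) \<in> borel_measurable (strip T)"
    if "continuous_on UNIV g" for g :: "real \<Rightarrow> real"
    using measurable_compose[OF um borel_measurable_continuous_onI[OF that]] by simp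
  have Jm: "J \<in> borel_measurable (strip T)"
    unfolding J_def using comp[OF cont(1)] comp[OF cont(2)] comp[OF q(2)] meas h(1) by measurable
  have "AE z in strip T. \<bar>J z\<bar> \<le> L * D1 + L * D3 + L * D2 * C"
    using h(2) AE_space
  proof eventually_elim
    case (elim z)
    then have t: "fst z \<in> {0..T}" by (auto simp: space_restrict_space)
    have b: "\<bar>u (fst z) (snd z)\<bar> \<le> B" using B(2)[OF t] .
    note bdz = bd[OF t, of "snd z"]
    have L0: "0 \<le> L" using bdz by linarith
    have "\<bar>J z\<bar> \<le> \<bar>\<psi>t (fst z) (snd z)\<bar> * \<bar>?\<eta> (u (fst z) (snd z))\<bar>
      + \<bar>\<psi>x (fst z) (snd z)\<bar> * \<bar>q (u (fst z) (snd z))\<bar>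
      + \<bar>\<psi> (fst z) (snd z)\<bar> * \<bar>\<eta>' (u (fst z) (snd z))\<bar> * \<bar>h (fst z) (snd z)\<bar>"
    proof -
      have "\<bar>\<sigma>\<bar> = 1" using \<sigma> by auto
      moreover have tri: "\<bar>x + y - w\<bar> \<le> \<bar>x\<bar> + \<bar>y\<bar> + \<bar>w\<bar>" for x y w :: real by linarith
      ultimately show ?thesis
        using tri[of "\<psi>t (fst z) (snd z) * ?\<eta> (u (fst z) (snd z))" "\<sigma> * \<psi>x (fst z) (snd z) * q (u (fst z) (snd z))"
            "\<psi> (fst z) (snd z) * \<eta>' (u (fst z) (snd z)) * h (fst z) (snd z)"]
        unfolding J_def by (simp add: abs_mult)
    qed
    also have "\<dots> \<le> L * D1 + L * D3 + L * D2 * C"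
      by (intro add_mono mult_mono) (use bdz b D1 D2 D3 elim L0 in auto)
    finally show ?case .
  qed
  then have Ji: "integrable (strip T) J"
    using Jm by (intro integrable_const_bound) auto
  have "(\<integral>x. \<psi> 0 x * ?\<eta> (u0 x) \<partial>circ) = 0"
    by (rule integral_eq_zero_AE)
      (use init in eventually_elim, auto simp: pos_entropy_def max.absorb1)
  moreover have "(\<integral>(t, x). deriv (\<lambda>s. \<psi> s x) t * ?\<eta> (u t x) + deriv (\<lambda>y. \<psi> t y) x * q (u t x)
          - \<psi> t x * avg_deriv ?\<eta> (u t x) * h t x \<partial>strip T) = (\<integral>z. J z \<partial>strip T)"
    by (rule Bochner_Integration.integral_cong)
      (auto simp: J_def avg_deriv_pos_entropy \<eta>'_def dt dx space_restrict_space simp del: power_Suc)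
  moreover have "(\<integral>(t, x). deriv (\<lambda>s. \<psi> s x) t * ?\<eta> (u t x) + deriv (\<lambda>y. \<psi> t y) x * q (u t x)
          - \<psi> t x * avg_deriv ?\<eta> (u t x) * h t x \<partial>strip T) + (\<integral>x. \<psi> 0 x * ?\<eta> (u0 x) \<partial>circ) \<ge> 0"
    using h(3) q(1) test convex_pos_entropy[OF \<tau>] unfolding entropy_inequality_def by blast
  ultimately have "0 \<le> (\<integral>z. J z \<partial>strip T)" by simp
  also have "\<dots> \<le> (\<integral>z. G z \<partial>strip T)"
  proof (rule integral_mono_AE[OF Ji G])
    show "AE z in strip T. J z \<le> G z"
      using h(4) le_M pw
    proof eventually_elim
      case (elim z)
      define s where "s = u (fst z) (snd z)"
      have Us: "U z = \<tau> * s" unfolding U_def s_def ..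
      have \<eta>s: "?\<eta> s = (max 0 (U z - k)) ^ Suc (Suc n)" unfolding pos_entropy_def Us ..
      \<comment> \<open>The actual speed is the quotient of flux and entropy; where it does not matter, \<open>lo\<close> is a
        default inside the admissible range.\<close>
      define c where "c = (if ?\<eta> s = 0 \<or> \<psi>x (fst z) (snd z) = 0 then lo else \<sigma> * q s / ?\<eta> s)"
      have \<eta>0: "k < U z" if "?\<eta> s \<noteq> 0" using that unfolding \<eta>s by (auto simp: max_def split: if_splits)
      have \<eta>nn: "0 \<le> ?\<eta> s" unfolding \<eta>s by (intro zero_le_power) simp
      have q0: "q s = 0" if "?\<eta> s = 0"
      proof -
        have "U z \<le> k" using that unfolding \<eta>s by (auto simp: max_def split: if_splits)
        then show ?thesis using q(3) Us by simp
      qed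
      have "lo \<le> c \<and> c \<le> hi"
      proof (cases "?\<eta> s = 0 \<or> \<psi>x (fst z) (snd z) = 0")
        case False
        then have "lo * ?\<eta> s \<le> \<sigma> * q s \<and> \<sigma> * q s \<le> hi * ?\<eta> s"
          using q(4)[of s] \<eta>0 elim(2) Us by auto
        then show ?thesis unfolding c_def using False \<eta>nn
          by (simp add: pos_le_divide_eq pos_divide_le_eq less_le)
      qed (use speeds(2) in \<open>auto simp: c_def\<close>)
      moreover have "0 < U z \<longrightarrow> a (snd z) * U z powr (1 - \<alpha>) \<le> \<tau> * h (fst z) (snd z)"
        using elim(1) \<tau> unfolding U_def by blast
      ultimately have "(\<psi>t (fst z) (snd z) + c * \<psi>x (fst z) (snd z)) * ?\<eta> s
        - \<psi> (fst z) (snd z) * (real (Suc (Suc n)) * (max 0 (U z - k)) ^ Suc n) * (\<tau> * h (fst z) (snd z)) \<le> G z"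
        using elim(3) unfolding \<eta>s by blast
      moreover have Q: "c * \<psi>x (fst z) (snd z) * ?\<eta> s = \<sigma> * \<psi>x (fst z) (snd z) * q s"
        unfolding c_def using q0 by auto
      have "J z = (\<psi>t (fst z) (snd z) + c * \<psi>x (fst z) (snd z)) * ?\<eta> s
        - \<psi> (fst z) (snd z) * (real (Suc (Suc n)) * (max 0 (U z - k)) ^ Suc n) * (\<tau> * h (fst z) (snd z))"
        unfolding J_def \<eta>'_def s_def[symmetric] Us distrib_right Q by (simp only: mult_ac)
      ultimately show "J z \<le> G z" by simp
    qed
  qed
  finally show ?thesis .
qed

text \<open>
  The test function \<open>T - t\<close> has no space derivative, which removes the flux term, and the damping term
  has the good sign.  This confines \<open>U\<close> to the range where the speed is monotone.
\<close>

lemma maximum_principle: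
  assumes T: "0 < T"
  shows "AE z in strip T. U z \<le> K"
proof -
  interpret finite_measure "strip T" by (rule strip_finite)
  define e where "e z = max 0 (U z - K)" for z
  obtain B where B: "0 \<le> B" "\<And>t x. t \<in> {0..T} \<Longrightarrow> \<bar>u t x\<bar> \<le> B" by (rule u_bounded[OF T]) (rule that, assumption+)
  have em: "e \<in> borel_measurable (strip T)" unfolding e_def using U_measurable[OF T] by measurable
  have "AE z in strip T. \<bar>e z ^ 2\<bar> \<le> B ^ 2"
    using AE_space
  proof eventually_elim
    case (elim z)
    have "\<bar>U z\<bar> \<le> B" using elim B(2) \<tau> unfolding U_def by (auto simp: space_restrict_space abs_mult)
    then have "0 \<le> e z" "e z \<le> B" using K B unfolding e_def by auto
    then show ?case by (auto intro: power_mono)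
  qed
  then have ei: "integrable (strip T) (\<lambda>z. e z ^ 2)"
    using em by (intro integrable_const_bound) auto
  have "0 \<le> (\<integral>z. - (e z ^ 2) \<partial>strip T)"
  proof (rule entropy_bound[OF T, where k=K and \<psi>="\<lambda>t x. T - t" and \<psi>t="\<lambda>t x. -1" and \<psi>x="\<lambda>t x. 0"
      and L="T + 1" and M=K and lo="speed K" and hi="speed K" and n=0])
    have "1-lipschitz_on ({0..T} \<times> UNIV) (\<lambda>(t, x::real). T - t)"
    proof (rule lipschitz_onI)
      fix p p' :: "real \<times> real"
      show "dist (case p of (t, x) \<Rightarrow> T - t) (case p' of (t, x) \<Rightarrow> T - t) \<le> 1 * dist p p'"
        using dist_fst_le[of p p'] by (simp add: case_prod_unfold dist_real_def abs_minus_commute)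
    qed simp
    moreover have "periodic_fun_simple' (\<lambda>x::real. T - t)" for t by unfold_locales auto
    ultimately show "lipschitz_test T (\<lambda>t x. T - t)" unfolding lipschitz_test_def by auto
    show "deriv (\<lambda>s. T - s) t = - 1" for t
      by (rule DERIV_imp_deriv) (auto intro!: derivative_eq_intros)
    show "(\<lambda>z. T - fst z) \<in> borel_measurable (strip T)"
      by (intro borel_measurable_strip borel_measurable_continuous_onI continuous_intros)
    show "AE z in strip T. \<forall>c H. speed K \<le> c \<longrightarrow> c \<le> speed K \<longrightarrow>
        (0 < U z \<longrightarrow> a (snd z) * U z powr (1 - \<alpha>) \<le> H) \<longrightarrow>
        (- 1 + c * 0) * (max 0 (U z - K)) ^ Suc (Suc 0)
        - (T - fst z) * (real (Suc (Suc 0)) * (max 0 (U z - K)) ^ Suc 0) * H \<le> - (e z ^ 2)"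
      using AE_space
    proof eventually_elim
      case (elim z)
      have "0 \<le> (T - fst z) * (2 * e z) * H" if "0 < U z \<longrightarrow> a (snd z) * U z powr (1 - \<alpha>) \<le> H" for H
      proof (cases "U z \<le> K")
        case False
        have "0 \<le> a (snd z) * U z powr (1 - \<alpha>)" using a_nonneg by simp
        then have "0 \<le> H" using that False K by auto
        then show ?thesis using elim by (auto simp: e_def space_restrict_space)
      qed (simp add: e_def max.absorb1)
      then show ?case by (auto simp: e_def power2_eq_square)
    qed
  qed (use K ei u0_le T in auto)
  then have "(\<integral>z. e z ^ 2 \<partial>strip T) \<le> 0" by simp
  moreover have "0 \<le> (\<integral>z. e z ^ 2 \<partial>strip T)"
    by (rule Bochner_Integration.integral_nonneg) simp
  ultimately have "(\<integral>z. e z ^ 2 \<partial>strip T) = 0" by linarith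
  then have "AE z in strip T. e z ^ 2 = 0"
    using integral_nonneg_eq_0_iff_AE[OF ei] by simp
  then show ?thesis by eventually_elim (auto simp: e_def max_def split: if_splits)
qed


text \<open>
  The barrier \<open>k + w\<close> has to be a supersolution for every speed between \<open>speed k\<close> and \<open>speed M\<close>.  In the
  damping term, \<open>a k powr (1 - \<alpha>) / (M - k)\<close> is a lower bound of the damping divided by \<open>U - k\<close>, since
  \<open>k < U \<le> M\<close>.  The cutoff may increase along the flow only where the bound \<open>U \<le> k + w\<close> is already
  known (assumption \<open>source\<close>): there the quotient \<open>E = max 0 (U - k) / w\<close> is at most \<open>1\<close>, and the error
  that the cutoff causes is bounded uniformly in the exponent.
\<close>

lemma comparison:
  fixes \<theta> \<theta>t \<theta>y w wt wy :: "real \<Rightarrow> real \<Rightarrow> real"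
  assumes T: "0 < T" and k: "0 \<le> k" "k < M" "M \<le> K"
    and \<theta>t: "\<And>t y. ((\<lambda>s. \<theta> s y) has_real_derivative \<theta>t t y) (at t)"
    and \<theta>y: "\<And>t y. (\<theta> t has_real_derivative \<theta>y t y) (at y)"
    and wt: "\<And>t y. ((\<lambda>s. w s y) has_real_derivative wt t y) (at t)"
    and wy: "\<And>t y. (w t has_real_derivative wy t y) (at y)"
    and cont: "continuous_on UNIV (\<lambda>(t, y). \<theta> t y)" "continuous_on UNIV (\<lambda>(t, y). \<theta>t t y)"
      "continuous_on UNIV (\<lambda>(t, y). \<theta>y t y)" "continuous_on UNIV (\<lambda>(t, y). w t y)"
      "continuous_on UNIV (\<lambda>(t, y). wt t y)" "continuous_on UNIV (\<lambda>(t, y). wy t y)"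
    and \<theta>_nonneg: "\<And>t y. 0 \<le> \<theta> t y"
    and \<theta>_supp: "\<And>t y. y \<notin> {0<..<1} \<Longrightarrow> \<theta> t y = 0"
    and \<theta>_init: "\<And>y. \<theta> 0 y = 0"
    and w_pos: "\<And>t y. 0 < w t y"
    and U_le: "AE z in strip T. 0 < \<theta> (fst z) (arc_coord \<sigma> b (snd z)) \<longrightarrow> U z \<le> M"
    and supersol: "\<And>t x c. t \<in> {0..T} \<Longrightarrow> 0 < \<theta> t (arc_coord \<sigma> b x) \<Longrightarrow> speed k \<le> c \<Longrightarrow> c \<le> speed M \<Longrightarrow>
      0 \<le> wt t (arc_coord \<sigma> b x) + c * wy t (arc_coord \<sigma> b x)
           + a x * k powr (1 - \<alpha>) / (M - k) * w t (arc_coord \<sigma> b x)"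
    and source: "AE z in strip T. 0 < \<theta> (fst z) (arc_coord \<sigma> b (snd z)) \<longrightarrow>
        (\<forall>c. speed k \<le> c \<longrightarrow> c \<le> speed M \<longrightarrow>
          \<theta>t (fst z) (arc_coord \<sigma> b (snd z)) + c * \<theta>y (fst z) (arc_coord \<sigma> b (snd z)) \<le> 0)
        \<or> U z \<le> k + w (fst z) (arc_coord \<sigma> b (snd z))"
  shows "AE z in strip T. 0 < \<theta> (fst z) (arc_coord \<sigma> b (snd z)) \<longrightarrow>
      U z \<le> k + w (fst z) (arc_coord \<sigma> b (snd z))"
proof -
  interpret finite_measure "strip T" by (rule strip_finite)
  define lo hi where "lo = speed k" and "hi = speed M"
  have speeds: "lo \<le> speed v \<and> speed v \<le> hi" if "v \<in> {k..M}" for v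
    using that k speed_mono unfolding lo_def hi_def by auto
  have lohi: "0 \<le> lo" "lo \<le> hi"
    using speeds[of k] k speed_lower[of k] c0 unfolding lo_def by (auto intro: order_trans[rotated])
  define y where "y z = arc_coord \<sigma> b (snd z)" for z :: "real \<times> real"
  have y_in: "y z \<in> {0..1}" for z using arc_coord_bounds[of \<sigma> b "snd z"] unfolding y_def by auto
  have arc_m: "arc_coord \<sigma> b \<in> borel_measurable borel"
    unfolding arc_coord_def frac_def by measurable
  have meas: "(\<lambda>z. g (fst z) (y z)) \<in> borel_measurable (strip T)"
    if "continuous_on UNIV (\<lambda>(t, y). g t y)" for g :: "real \<Rightarrow> real \<Rightarrow> real"
  proof (rule borel_measurable_strip)
    have "(\<lambda>z. (fst z, y z)) \<in> borel_measurable (borel :: (real \<times> real) measure)"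
      unfolding y_def using arc_m by (simp add: borel_prod[symmetric])
    from measurable_compose[OF this borel_measurable_continuous_onI[OF that]]
    show "(\<lambda>z. g (fst z) (y z)) \<in> borel_measurable borel" by simp
  qed
  have bdd: "\<exists>L\<ge>0. \<forall>t\<in>{0..T}. \<forall>y\<in>{0..1}. \<bar>g t y\<bar> \<le> L"
    if "continuous_on UNIV (\<lambda>(t, y). g t y)" for g :: "real \<Rightarrow> real \<Rightarrow> real"
  proof -
    have "compact ({0..T} \<times> {0..1::real})" by (intro compact_Times) auto
    then have "bounded ((\<lambda>(t, y). g t y) ` ({0..T} \<times> {0..1}))"
      using that by (meson compact_continuous_image compact_imp_bounded continuous_on_subset subset_UNIV)
    then obtain L where "\<forall>z\<in>{0..T} \<times> {0..1}. \<bar>g (fst z) (snd z)\<bar> \<le> L"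
      unfolding bounded_real by (auto simp: case_prod_unfold)
    then show ?thesis by (intro exI[of _ "max 0 L"]) (auto intro: max.coboundedI2)
  qed
  obtain L1 where L1: "0 \<le> L1" "\<And>t y. t \<in> {0..T} \<Longrightarrow> y \<in> {0..1} \<Longrightarrow> \<bar>\<theta>t t y\<bar> \<le> L1"
    using bdd[OF cont(2)] by auto
  obtain L2 where L2: "0 \<le> L2" "\<And>t y. t \<in> {0..T} \<Longrightarrow> y \<in> {0..1} \<Longrightarrow> \<bar>\<theta>y t y\<bar> \<le> L2"
    using bdd[OF cont(3)] by auto
  define C where "C = T * (L1 + hi * L2)"
  have C0: "0 \<le> C" unfolding C_def using T L1(1) L2(1) lohi by auto
  define e where "e z = max 0 (U z - k)" for z
  define E where "E z = e z / w (fst z) (y z)" for z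
  have em: "e \<in> borel_measurable (strip T)" unfolding e_def using U_measurable[OF T] by measurable
  have Em: "E \<in> borel_measurable (strip T)" unfolding E_def using em meas[OF cont(4)] by measurable
  have E_nonneg: "0 \<le> E z" for z unfolding E_def e_def by (intro divide_nonneg_pos w_pos) simp
  have \<theta>_zero: "\<theta>t t y = 0" "\<theta>y t y = 0" if "\<theta> t y = 0" for t y
    using deriv_zero_at_nonneg_root[OF _ that \<theta>t] deriv_zero_at_nonneg_root[OF _ that \<theta>y] \<theta>_nonneg by auto
  have inv_cont: "continuous_on UNIV (\<lambda>(t, y). inverse (w t y))"
    using cont(4) w_pos unfolding case_prod_unfold
    by (intro continuous_on_inverse) (auto simp: less_imp_neq[symmetric])
  have int: "integrable (strip T) (\<lambda>z. \<theta> (fst z) (y z) * E z ^ Suc (Suc n))" for n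
  proof -
    obtain B where B: "0 \<le> B" "\<And>t x. t \<in> {0..T} \<Longrightarrow> \<bar>u t x\<bar> \<le> B" by (rule u_bounded[OF T]) (rule that, assumption+)
    obtain D where D: "0 \<le> D" "\<And>t y. t \<in> {0..T} \<Longrightarrow> y \<in> {0..1} \<Longrightarrow> \<bar>\<theta> t y\<bar> \<le> D"
      using bdd[OF cont(1)] by auto
    obtain W where W: "0 \<le> W" "\<And>t y. t \<in> {0..T} \<Longrightarrow> y \<in> {0..1} \<Longrightarrow> \<bar>inverse (w t y)\<bar> \<le> W"
      using bdd[OF inv_cont] by auto
    have "AE z in strip T. \<bar>\<theta> (fst z) (y z) * E z ^ Suc (Suc n)\<bar> \<le> D * (B * W) ^ Suc (Suc n)"
      using AE_space
    proof eventually_elim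
      case (elim z)
      then have t: "fst z \<in> {0..T}" by (auto simp: space_restrict_space)
      have "\<bar>U z\<bar> \<le> B" using t B(2) \<tau> unfolding U_def by (auto simp: abs_mult)
      then have "0 \<le> e z" "e z \<le> B" using k B unfolding e_def by auto
      then have "\<bar>E z\<bar> \<le> B * W" unfolding E_def divide_inverse abs_mult using W(2)[OF t y_in] B W
        by (intro mult_mono) auto
      then show ?case unfolding abs_mult power_abs using D(2)[OF t y_in] D(1)
        by (intro mult_mono power_mono) auto
    qed
    moreover have "(\<lambda>z. \<theta> (fst z) (y z) * E z ^ Suc (Suc n)) \<in> borel_measurable (strip T)"
      using Em meas[OF cont(1)] by measurable
    ultimately show ?thesis by (intro integrable_const_bound) auto
  qed
  \<comment> \<open>The constant \<open>C\<close> is independent of \<open>n\<close>; this is what allows the exponent to tend to infinity.\<close>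
  have bound: "(\<integral>z. \<theta> (fst z) (y z) * E z ^ Suc (Suc n) \<partial>strip T) \<le> (\<integral>z. C \<partial>strip T)" for n
  proof -
    define p where "p = real (Suc (Suc n))"
    define V where "V t y = inverse (w t y)" for t y
    define \<Psi> where "\<Psi> t y = (T - t) * \<theta> t y * V t y ^ Suc (Suc n)" for t y
    define \<Psi>t where "\<Psi>t t y = (- \<theta> t y + (T - t) * \<theta>t t y) * V t y ^ Suc (Suc n)
       - (T - t) * \<theta> t y * (p * V t y ^ Suc n * (wt t y * V t y ^ 2))" for t y
    define \<Psi>y where "\<Psi>y t y = (T - t) * \<theta>y t y * V t y ^ Suc (Suc n)
       - (T - t) * \<theta> t y * (p * V t y ^ Suc n * (wy t y * V t y ^ 2))" for t y
    have w0: "w t y \<noteq> 0" for t y using w_pos[of t y] by simp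
    have Vt: "((\<lambda>s. V s y) has_real_derivative - (wt t y * V t y ^ 2)) (at t)" for t y
      unfolding V_def by (rule DERIV_cong[OF DERIV_inverse_fun[OF wt w0]]) (simp add: power2_eq_square)
    have Vy: "(V t has_real_derivative - (wy t y * V t y ^ 2)) (at y)" for t y
      unfolding V_def by (rule DERIV_cong[OF DERIV_inverse_fun[OF wy w0]]) (simp add: power2_eq_square)
    have d1: "((\<lambda>s. \<Psi> s y) has_real_derivative \<Psi>t t y) (at t)" for t y
      unfolding \<Psi>_def \<Psi>t_def p_def
      by (rule derivative_eq_intros \<theta>t Vt refl | simp add: algebra_simps del: power_Suc)+
    have d2: "(\<Psi> t has_real_derivative \<Psi>y t y) (at y)" for t y
      unfolding \<Psi>_def \<Psi>y_def p_def
      by (rule derivative_eq_intros \<theta>y Vy refl | simp add: algebra_simps del: power_Suc)+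
    note c = cont[unfolded case_prod_unfold] inv_cont[unfolded case_prod_unfold, folded V_def]
    have cont': "continuous_on UNIV (\<lambda>(t, y). \<Psi> t y)" "continuous_on UNIV (\<lambda>(t, y). \<Psi>t t y)"
      "continuous_on UNIV (\<lambda>(t, y). \<Psi>y t y)"
      unfolding \<Psi>_def \<Psi>t_def \<Psi>y_def case_prod_unfold by (intro continuous_intros c)+
    obtain D1 where D1: "0 \<le> D1" "\<And>t y. t \<in> {0..T} \<Longrightarrow> y \<in> {0..1} \<Longrightarrow> \<bar>\<Psi> t y\<bar> \<le> D1"
      using bdd[OF cont'(1)] by auto
    obtain D2 where D2: "0 \<le> D2" "\<And>t y. t \<in> {0..T} \<Longrightarrow> y \<in> {0..1} \<Longrightarrow> \<bar>\<Psi>t t y\<bar> \<le> D2"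
      using bdd[OF cont'(2)] by auto
    obtain D3 where D3: "0 \<le> D3" "\<And>t y. t \<in> {0..T} \<Longrightarrow> y \<in> {0..1} \<Longrightarrow> \<bar>\<Psi>y t y\<bar> \<le> D3"
      using bdd[OF cont'(3)] by auto
    have V_pos: "0 < V t y" for t y unfolding V_def using w_pos by simp
    have \<Psi>_nonneg: "0 \<le> \<Psi> t y" if "t \<in> {0..T}" for t y
      unfolding \<Psi>_def using that \<theta>_nonneg V_pos[THEN less_imp_le]
      by (intro mult_nonneg_nonneg zero_le_power) auto
    have \<Psi>_supp: "\<Psi> t y = 0" if "y \<notin> {0<..<1}" for t y
      unfolding \<Psi>_def using \<theta>_supp[OF that] by simp
    note test = arc_test_function[where b=b, OF \<sigma> less_imp_le[OF T] d1 d2 cont'(2,3) \<Psi>_nonneg \<Psi>_supp]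
    have "0 \<le> (\<integral>z. C - \<theta> (fst z) (y z) * E z ^ Suc (Suc n) \<partial>strip T)"
    proof (rule entropy_bound[OF T k(1), where \<psi>="\<lambda>t x. \<Psi> t (arc_coord \<sigma> b x)"
        and \<psi>t="\<lambda>t x. \<Psi>t t (arc_coord \<sigma> b x)" and \<psi>x="\<lambda>t x. \<Psi>y t (arc_coord \<sigma> b x)"
        and L="max D1 (max D2 D3)" and M=M and lo=lo and hi=hi and n=n])
      show "lipschitz_test T (\<lambda>t x. \<Psi> t (arc_coord \<sigma> b x))"
        by (rule test(1)) (auto simp: \<Psi>_def)
      show "deriv (\<lambda>s. \<Psi> s (arc_coord \<sigma> b x)) t = \<Psi>t t (arc_coord \<sigma> b x)" for t x
        by (rule test(3)) (auto simp: \<Psi>_def)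
      show "deriv (\<lambda>x. \<Psi> t (arc_coord \<sigma> b x)) x = \<sigma> * \<Psi>y t (arc_coord \<sigma> b x)" if "t \<in> {0..T}" for t x
        by (rule test(2)) (use that in \<open>auto simp: \<Psi>_def\<close>)
      show "(\<lambda>z. \<Psi> (fst z) (arc_coord \<sigma> b (snd z))) \<in> borel_measurable (strip T)"
        "(\<lambda>z. \<Psi>t (fst z) (arc_coord \<sigma> b (snd z))) \<in> borel_measurable (strip T)"
        "(\<lambda>z. \<Psi>y (fst z) (arc_coord \<sigma> b (snd z))) \<in> borel_measurable (strip T)"
        using cont'[THEN meas] unfolding y_def by auto
      show "\<bar>\<Psi> t (arc_coord \<sigma> b x)\<bar> \<le> max D1 (max D2 D3) \<and> \<bar>\<Psi>t t (arc_coord \<sigma> b x)\<bar> \<le> max D1 (max D2 D3)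
         \<and> \<bar>\<Psi>y t (arc_coord \<sigma> b x)\<bar> \<le> max D1 (max D2 D3)" if "t \<in> {0..T}" for t x
      proof -
        have "arc_coord \<sigma> b x \<in> {0..1}" using y_in[of "(t, x)"] unfolding y_def by simp
        then show ?thesis using that D1(2) D2(2) D3(2) by (simp add: le_max_iff_disj)
      qed
      show "AE x in circ. \<Psi> 0 (arc_coord \<sigma> b x) = 0 \<or> \<tau> * u0 x \<le> k"
        unfolding \<Psi>_def \<theta>_init by simp
      show "AE z in strip T. \<Psi>y (fst z) (arc_coord \<sigma> b (snd z)) \<noteq> 0 \<longrightarrow> U z \<le> M"
        using U_le
      proof eventually_elim
        case (elim z)
        show ?case
        proof (cases "\<theta> (fst z) (arc_coord \<sigma> b (snd z)) = 0")
          case False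
          then show ?thesis using elim \<theta>_nonneg[of "fst z" "arc_coord \<sigma> b (snd z)"] by simp
        qed (simp add: \<Psi>y_def \<theta>_zero)
      qed
      show "AE z in strip T. \<forall>c H. lo \<le> c \<longrightarrow> c \<le> hi \<longrightarrow>
        (0 < U z \<longrightarrow> a (snd z) * U z powr (1 - \<alpha>) \<le> H) \<longrightarrow>
        (\<Psi>t (fst z) (arc_coord \<sigma> b (snd z)) + c * \<Psi>y (fst z) (arc_coord \<sigma> b (snd z))) * (max 0 (U z - k)) ^ Suc (Suc n)
        - \<Psi> (fst z) (arc_coord \<sigma> b (snd z)) * (real (Suc (Suc n)) * (max 0 (U z - k)) ^ Suc n) * H
        \<le> C - \<theta> (fst z) (y z) * E z ^ Suc (Suc n)"
        using U_le source AE_space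
      proof eventually_elim
        case (elim z)
        define t where "t = fst z"
        define Y where "Y = arc_coord \<sigma> b (snd z)"
        have t: "t \<in> {0..T}" using elim(3) unfolding t_def by (auto simp: space_restrict_space)
        have Y: "Y \<in> {0..1}" using y_in[of z] unfolding y_def Y_def .
        have yY: "y z = Y" unfolding y_def Y_def ..
        have ez: "max 0 (U z - k) = e z" unfolding e_def ..
        show ?case unfolding t_def[symmetric] Y_def[symmetric] yY ez p_def[symmetric]
        proof (intro allI impI)
          fix c H assume c: "lo \<le> c" "c \<le> hi" and H: "0 < U z \<longrightarrow> a (snd z) * U z powr (1 - \<alpha>) \<le> H"
          show "(\<Psi>t t Y + c * \<Psi>y t Y) * e z ^ Suc (Suc n) - \<Psi> t Y * (p * e z ^ Suc n) * H
             \<le> C - \<theta> t Y * E z ^ Suc (Suc n)"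
          proof (cases "\<theta> t Y = 0 \<or> e z = 0")
            case True
            then have "\<Psi> t Y = 0 \<and> \<Psi>t t Y = 0 \<and> \<Psi>y t Y = 0 \<or> e z = 0"
              unfolding \<Psi>_def \<Psi>t_def \<Psi>y_def using \<theta>_zero by auto
            then have lhs: "(\<Psi>t t Y + c * \<Psi>y t Y) * e z ^ Suc (Suc n) - \<Psi> t Y * (p * e z ^ Suc n) * H = 0" by auto
            have rhs: "\<theta> t Y * E z ^ Suc (Suc n) = 0" using True unfolding E_def by auto
            show ?thesis unfolding lhs rhs using C0 by simp
          next
            case False
            then have \<theta>pos: "0 < \<theta> t Y" using \<theta>_nonneg[of t Y] by simp
            have kU: "k < U z" and epos: "0 < e z" and eU: "e z = U z - k"
              using False unfolding e_def by (auto simp: max_def split: if_splits)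
            have UM: "U z \<le> M" using elim(1) \<theta>pos unfolding t_def Y_def by simp
            have EV: "E z = e z * V t Y" unfolding E_def V_def yY t_def divide_inverse ..
            \<comment> \<open>\<open>Q\<close> is the supersolution expression divided by \<open>w\<close>, with the actual damping \<open>H\<close>.\<close>
            define Q where "Q = V t Y * (wt t Y + c * wy t Y) + H / e z"
            have Q: "0 \<le> Q"
            proof -
              have "a (snd z) * k powr (1 - \<alpha>) \<le> a (snd z) * U z powr (1 - \<alpha>)"
                using kU k a_nonneg \<alpha> by (intro mult_left_mono powr_mono2) auto
              also have "\<dots> \<le> H" using H kU k by auto
              finally have aH: "a (snd z) * k powr (1 - \<alpha>) \<le> H" .
              have "a (snd z) * k powr (1 - \<alpha>) / (M - k) \<le> H / e z"
              proof (rule frac_le)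
                show "0 \<le> H" using aH a_nonneg by (rule_tac order_trans[OF _ aH]) auto
              qed (use aH epos eU UM in auto)
              moreover have "0 \<le> V t Y * (wt t Y + c * wy t Y
                  + a (snd z) * k powr (1 - \<alpha>) / (M - k) * w t Y)"
                using supersol[OF t, of "snd z" c] \<theta>pos c V_pos[of t Y] unfolding Y_def lo_def hi_def
                by (intro mult_nonneg_nonneg) auto
              moreover have "V t Y * w t Y = 1" unfolding V_def using w0 by simp
              then have "V t Y * (wt t Y + c * wy t Y + a (snd z) * k powr (1 - \<alpha>) / (M - k) * w t Y)
                 = V t Y * (wt t Y + c * wy t Y) + a (snd z) * k powr (1 - \<alpha>) / (M - k)"
                by (simp add: distrib_left mult.left_commute mult.commute)
              ultimately show ?thesis unfolding Q_def by linarith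
            qed
            have main: "(\<Psi>t t Y + c * \<Psi>y t Y) * e z ^ Suc (Suc n) - \<Psi> t Y * (p * e z ^ Suc n) * H
              = - (\<theta> t Y * E z ^ Suc (Suc n)) + (T - t) * (\<theta>t t Y + c * \<theta>y t Y) * E z ^ Suc (Suc n)
                - (T - t) * \<theta> t Y * p * E z ^ Suc (Suc n) * Q"
            proof -
              have "H / e z * E z ^ Suc (Suc n) = H * e z ^ Suc n * V t Y ^ Suc (Suc n)"
                unfolding EV power_mult_distrib using epos by simp
              then show ?thesis
                unfolding \<Psi>_def \<Psi>t_def \<Psi>y_def Q_def EV power_mult_distrib
                by (simp add: algebra_simps power2_eq_square)
            qed
            have third: "0 \<le> (T - t) * \<theta> t Y * p * E z ^ Suc (Suc n) * Q"
              using t \<theta>pos E_nonneg[of z] Q unfolding p_def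
              by (intro mult_nonneg_nonneg zero_le_power) auto
            have second: "(T - t) * (\<theta>t t Y + c * \<theta>y t Y) * E z ^ Suc (Suc n) \<le> C"
            proof (cases "\<theta>t t Y + c * \<theta>y t Y \<le> 0")
              case True
              then have "(T - t) * (\<theta>t t Y + c * \<theta>y t Y) * E z ^ Suc (Suc n) \<le> 0"
                using t E_nonneg[of z] by (intro mult_nonpos_nonneg mult_nonneg_nonpos zero_le_power) auto
              then show ?thesis using C0 by linarith
            next
              case False
              then have "U z \<le> k + w t Y"
                using elim(2) \<theta>pos c unfolding t_def[symmetric] Y_def[symmetric] lo_def hi_def by auto
              then have "E z \<le> 1" unfolding E_def yY t_def[symmetric] eU using w_pos[of t Y] by simp
              then have E1: "E z ^ Suc (Suc n) \<le> 1" using E_nonneg by (intro power_le_one)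
              have "c * \<theta>y t Y \<le> hi * L2"
              proof -
                have "c * \<theta>y t Y \<le> c * \<bar>\<theta>y t Y\<bar>" using c lohi by (intro mult_left_mono) auto
                also have "\<dots> \<le> hi * L2" using c lohi L2(2)[OF t Y] by (intro mult_mono) auto
                finally show ?thesis .
              qed
              then have "\<theta>t t Y + c * \<theta>y t Y \<le> L1 + hi * L2" using L1(2)[OF t Y] by linarith
              then have "(T - t) * (\<theta>t t Y + c * \<theta>y t Y) * E z ^ Suc (Suc n) \<le> T * (L1 + hi * L2) * 1"
                using False t E1 E_nonneg[of z] by (intro mult_mono) auto
              then show ?thesis unfolding C_def by simp
            qed
            show ?thesis unfolding main using second third by linarith
          qed
        qed
      qed
      show "integrable (strip T) (\<lambda>z. C - \<theta> (fst z) (y z) * E z ^ Suc (Suc n))"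
        using int by (intro Bochner_Integration.integrable_diff) auto
    qed (use speeds lohi in auto)
    then show ?thesis using int by (subst (asm) Bochner_Integration.integral_diff) auto
  qed
  have "AE z in strip T. 0 < \<theta> (fst z) (y z) \<longrightarrow> E z \<le> 1"
    using uniform_power_bound_imp_le_one[OF strip_finite meas[OF cont(1)] Em \<theta>_nonneg E_nonneg int bound] .
  then show ?thesis
  proof eventually_elim
    case (elim z)
    show ?case
    proof
      assume "0 < \<theta> (fst z) (arc_coord \<sigma> b (snd z))"
      then have "E z \<le> 1" using elim unfolding y_def by simp
      then have "e z \<le> w (fst z) (arc_coord \<sigma> b (snd z))"
        unfolding E_def y_def using w_pos by (simp add: pos_divide_le_eq)
      then show "U z \<le> k + w (fst z) (arc_coord \<sigma> b (snd z))" unfolding e_def by auto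
    qed
  qed
qed

end

section \<open>One step of decrease\<close>

lemma arc_coord_shift:
  assumes \<sigma>: "\<sigma> \<in> {1, -1}" and e: "0 \<le> e" "e + arc_coord \<sigma> (b + \<sigma> * e) x < 1"
  shows "arc_coord \<sigma> b x = e + arc_coord \<sigma> (b + \<sigma> * e) x"
proof -
  have \<sigma>2: "\<sigma> * \<sigma> = 1" using \<sigma> by auto
  have eq: "\<sigma> * (x - (b + \<sigma> * e)) = \<sigma> * (x - b) - e"
    using \<sigma>2 by (simp add: algebra_simps)
  have "\<sigma> * (x - b) - (e + arc_coord \<sigma> (b + \<sigma> * e) x) \<in> \<int>"
    unfolding arc_coord_def eq by (simp add: frac_def)
  then show ?thesis
    unfolding arc_coord_def[of \<sigma> b] frac_unique_iff using e arc_coord_bounds[of \<sigma> "b + \<sigma> * e" x] by auto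
qed

lemma AE_arc_coord_nonzero:
  assumes \<sigma>: "\<sigma> \<in> {1, -1}"
  shows "AE x in circ. arc_coord \<sigma> b x \<noteq> 0"
proof -
  have "range (\<lambda>n::int. b + \<sigma> * of_int n) \<in> null_sets lborel"
    by (intro countable_imp_null_set_lborel) auto
  from AE_not_in[OF this] show ?thesis unfolding AE_circ_iff
  proof eventually_elim
    case (elim x)
    show ?case
    proof (intro impI notI)
      assume "arc_coord \<sigma> b x = 0"
      then obtain n :: int where "\<sigma> * (x - b) = of_int n"
        unfolding arc_coord_def frac_eq_0_iff by (auto elim: Ints_cases)
      then have "\<sigma> * of_int n = \<sigma> * \<sigma> * (x - b)" by simp
      moreover have "\<sigma> * \<sigma> = 1" using \<sigma> by auto
      ultimately have "x = b + \<sigma> * of_int n" by simp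
      then show False using elim by auto
    qed
  qed
qed

context one_sided_solution
begin

definition le_after :: "real \<Rightarrow> real \<Rightarrow> real set \<Rightarrow> real \<Rightarrow> bool"
  where "le_after t0 b I M \<longleftrightarrow>
    (\<forall>T>0. AE z in strip T. t0 < fst z \<longrightarrow> arc_coord \<sigma> b (snd z) \<in> I \<longrightarrow> U z \<le> M)"

lemma le_afterD:
  "le_after t0 b I M \<Longrightarrow> 0 < T \<Longrightarrow>
    AE z in strip T. t0 < fst z \<longrightarrow> arc_coord \<sigma> b (snd z) \<in> I \<longrightarrow> U z \<le> M"
  unfolding le_after_def by blast

lemma le_after_weaken:
  assumes "le_after t0 b I M" "t0 \<le> t1" "J \<subseteq> I" "M \<le> N"
  shows "le_after t1 b J N"
  unfolding le_after_def
proof (intro allI impI)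
  fix T :: real assume "0 < T"
  from le_afterD[OF assms(1) this]
  show "AE z in strip T. t1 < fst z \<longrightarrow> arc_coord \<sigma> b (snd z) \<in> J \<longrightarrow> U z \<le> N"
    by eventually_elim (use assms(2-4) in auto)
qed

text \<open>
  The open interval \<open>(0, 1)\<close> misses only the base point, so a bound on it holds on the whole circle
  and can be read from any other base point.
\<close>

lemma le_after_full_circle:
  assumes "le_after t0 b {0<..<1} M"
  shows "le_after t0 b' I M"
  unfolding le_after_def
proof (intro allI impI)
  fix T :: real assume "0 < T"
  from le_afterD[OF assms this] AE_strip_of_circ[OF AE_arc_coord_nonzero[OF \<sigma>, of b]]
  show "AE z in strip T. t0 < fst z \<longrightarrow> arc_coord \<sigma> b' (snd z) \<in> I \<longrightarrow> U z \<le> M"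
  proof eventually_elim
    case (elim z)
    then have "arc_coord \<sigma> b (snd z) \<in> {0<..<1}"
      using arc_coord_bounds[of \<sigma> b "snd z"] by auto
    then show ?case using elim by auto
  qed
qed

lemma speed_nonneg: "0 \<le> v \<Longrightarrow> v \<le> K \<Longrightarrow> 0 \<le> speed v"
  using speed_lower[of v] c0 by (auto intro: order_trans[rotated])

text \<open>
  The barrier \<open>w\<close> falls from \<open>M / 2\<close> to \<open>(1 - \<epsilon>) M / 2\<close> within the time \<open>s\<close> and the distance \<open>\<xi>\<close>.  The
  assumption \<open>small\<close> says that damping outweighs the slope of \<open>w\<close> at the largest possible speed.  At the
  right end \<open>\<rho>\<close> the cutoff decreases along the flow, so the bound holds up to \<open>\<rho>\<close> without loss.  The
  first \<open>s\<close> and \<open>\<xi>\<close> are spent on switching on the cutoff while \<open>w = M / 2\<close>, hence the factors \<open>2\<close>.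
\<close>

lemma damping_step:
  assumes t0: "0 \<le> t0" and y0: "0 \<le> y0" and \<rho>: "\<rho> \<le> 1" and M: "0 < M" "M \<le> K"
    and scales: "0 < s" "0 < \<xi>" and \<epsilon>: "0 < \<epsilon>" "\<epsilon> < 1" and \<delta>: "0 \<le> \<delta>"
    and damped: "\<And>x. arc_coord \<sigma> b x \<in> {0<..<\<rho>} \<Longrightarrow> \<delta> \<le> a x"
    and small: "\<epsilon> * (2 / s + 2 * speed M / \<xi>) \<le> \<delta> * (1 - \<epsilon>) * (M / 2) powr (-\<alpha>)"
    and hyp: "le_after t0 b {y0<..<\<rho>} M"
  shows "le_after (t0 + 2 * s) b {y0 + 2 * \<xi><..<\<rho>} ((1 - \<epsilon> / 2) * M)"
  unfolding le_after_def
proof (intro allI impI)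
  fix T :: real assume T: "0 < T"
  define \<theta> where "\<theta> t y = smooth_step ((t - t0) / s) * smooth_step ((y - y0) / \<xi>) * pos_sq (\<rho> - y)" for t y
  define \<theta>t where "\<theta>t t y = smooth_step' ((t - t0) / s) / s * smooth_step ((y - y0) / \<xi>) * pos_sq (\<rho> - y)" for t y
  define \<theta>y where "\<theta>y t y = smooth_step ((t - t0) / s) * (smooth_step' ((y - y0) / \<xi>) / \<xi> * pos_sq (\<rho> - y)
      - smooth_step ((y - y0) / \<xi>) * (2 * max 0 (\<rho> - y)))" for t y
  define w where "w t y = M / 2 * (1 - \<epsilon> * smooth_step ((t - t0 - s) / s) * smooth_step ((y - y0 - \<xi>) / \<xi>))" for t y
  define wt where "wt t y = - (M / 2 * \<epsilon> * (smooth_step' ((t - t0 - s) / s) / s) * smooth_step ((y - y0 - \<xi>) / \<xi>))" for t y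
  define wy where "wy t y = - (M / 2 * \<epsilon> * smooth_step ((t - t0 - s) / s) * (smooth_step' ((y - y0 - \<xi>) / \<xi>) / \<xi>))" for t y
  note sb = smooth_step_bounds smooth_step'_bounds
  have nz: "s \<noteq> 0" "\<xi> \<noteq> 0" using scales by auto
  have \<theta>_pos_iff: "0 < \<theta> t y \<longleftrightarrow> t0 < t \<and> y0 < y \<and> y < \<rho>" for t y
  proof
    assume "0 < \<theta> t y"
    then have "smooth_step ((t - t0) / s) \<noteq> 0" "smooth_step ((y - y0) / \<xi>) \<noteq> 0" "pos_sq (\<rho> - y) \<noteq> 0"
      unfolding \<theta>_def by auto
    then have "\<not> (t - t0) / s \<le> 0" "\<not> (y - y0) / \<xi> \<le> 0" "\<not> \<rho> - y \<le> 0"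
      using smooth_step_eq_0 by (auto simp: pos_sq_def max_def split: if_splits)
    then show "t0 < t \<and> y0 < y \<and> y < \<rho>" using scales by (auto simp: divide_le_0_iff)
  next
    assume "t0 < t \<and> y0 < y \<and> y < \<rho>"
    then show "0 < \<theta> t y" unfolding \<theta>_def using scales
      by (intro mult_pos_pos smooth_step_pos divide_pos_pos) (auto simp: pos_sq_def)
  qed
  have \<theta>_nonneg: "0 \<le> \<theta> t y" for t y
    unfolding \<theta>_def using sb by (intro mult_nonneg_nonneg) (auto simp: pos_sq_def)
  have \<theta>_zero: "\<theta> t y = 0" if "t \<le> t0 \<or> y \<le> y0 \<or> \<rho> \<le> y" for t y
    using \<theta>_pos_iff[of t y] \<theta>_nonneg[of t y] that by linarith
  have w_low: "M / 2 * (1 - \<epsilon>) \<le> w t y" for t y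
  proof -
    have "smooth_step ((t - t0 - s) / s) * smooth_step ((y - y0 - \<xi>) / \<xi>) \<le> 1"
      using sb by (intro mult_le_one) auto
    then have "\<epsilon> * (smooth_step ((t - t0 - s) / s) * smooth_step ((y - y0 - \<xi>) / \<xi>)) \<le> \<epsilon>"
      using \<epsilon> by simp
    then show ?thesis unfolding w_def using M by (intro mult_left_mono) (auto simp: mult.assoc)
  qed
  have low_pos: "0 < M / 2 * (1 - \<epsilon>)" using M \<epsilon> by simp
  have hyp': "AE z in strip T. 0 < \<theta> (fst z) (arc_coord \<sigma> b (snd z)) \<longrightarrow> U z \<le> M"
    using le_afterD[OF hyp T] by eventually_elim (auto simp: \<theta>_pos_iff)
  have sM: "0 \<le> speed (M / 2)" using M speed_nonneg by simp
  have "AE z in strip T. 0 < \<theta> (fst z) (arc_coord \<sigma> b (snd z)) \<longrightarrow>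
      U z \<le> M / 2 + w (fst z) (arc_coord \<sigma> b (snd z))"
  proof (rule comparison[OF T, where k="M / 2" and M=M and \<theta>t=\<theta>t and \<theta>y=\<theta>y and wt=wt and wy=wy])
    show "((\<lambda>s. \<theta> s y) has_real_derivative \<theta>t t y) (at t)" for t y
      unfolding \<theta>_def \<theta>t_def by (auto intro!: derivative_eq_intros simp: nz field_simps)
    show "(\<theta> t has_real_derivative \<theta>y t y) (at y)" for t y
      unfolding \<theta>_def \<theta>y_def by (auto intro!: derivative_eq_intros simp: nz field_simps)
    show "((\<lambda>s. w s y) has_real_derivative wt t y) (at t)" for t y
      unfolding w_def wt_def by (auto intro!: derivative_eq_intros simp: nz field_simps)
    show "(w t has_real_derivative wy t y) (at y)" for t y
      unfolding w_def wy_def by (auto intro!: derivative_eq_intros simp: nz field_simps)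
    show "continuous_on UNIV (\<lambda>(t, y). \<theta> t y)" "continuous_on UNIV (\<lambda>(t, y). \<theta>t t y)"
      "continuous_on UNIV (\<lambda>(t, y). \<theta>y t y)" "continuous_on UNIV (\<lambda>(t, y). w t y)"
      "continuous_on UNIV (\<lambda>(t, y). wt t y)" "continuous_on UNIV (\<lambda>(t, y). wy t y)"
      unfolding \<theta>_def \<theta>t_def \<theta>y_def w_def wt_def wy_def case_prod_unfold divide_inverse
      by (intro continuous_intros)+
    show "\<theta> t y = 0" if "y \<notin> {0<..<1}" for t y
      using that y0 \<rho> by (intro \<theta>_zero) auto
    show "\<theta> 0 y = 0" for y using t0 by (intro \<theta>_zero) auto
    show "0 < w t y" for t y using w_low[of t y] low_pos by linarith
    show "0 \<le> wt t (arc_coord \<sigma> b x) + c * wy t (arc_coord \<sigma> b x)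
           + a x * (M / 2) powr (1 - \<alpha>) / (M - M / 2) * w t (arc_coord \<sigma> b x)"
      if "0 < \<theta> t (arc_coord \<sigma> b x)" "speed (M / 2) \<le> c" "c \<le> speed M" for t x c
    proof -
      define y where "y = arc_coord \<sigma> b x"
      have ax: "\<delta> \<le> a x" using that(1) y0 by (intro damped) (auto simp: \<theta>_pos_iff)
      have "M / 2 * \<epsilon> * ((smooth_step' ((t - t0 - s) / s) / s) * smooth_step ((y - y0 - \<xi>) / \<xi>))
         \<le> M / 2 * \<epsilon> * ((2 / s) * 1)"
        using sb M \<epsilon> scales by (intro mult_left_mono mult_mono divide_right_mono) auto
      then have 1: "- (M / 2 * \<epsilon> * (2 / s)) \<le> wt t y" unfolding wt_def by (simp add: mult.assoc)
      have "c * (M / 2 * \<epsilon> * (smooth_step ((t - t0 - s) / s) * (smooth_step' ((y - y0 - \<xi>) / \<xi>) / \<xi>)))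
         \<le> speed M * (M / 2 * \<epsilon> * (1 * (2 / \<xi>)))"
        using sb M \<epsilon> scales that sM
        by (intro mult_mono mult_left_mono divide_right_mono mult_nonneg_nonneg) auto
      then have 2: "- (M / 2 * \<epsilon> * (2 * speed M / \<xi>)) \<le> c * wy t y" unfolding wy_def by (simp add: mult_ac)
      have "M / 2 * (\<epsilon> * (2 / s + 2 * speed M / \<xi>)) \<le> M / 2 * (\<delta> * (1 - \<epsilon>) * (M / 2) powr (-\<alpha>))"
        using small M by (intro mult_left_mono) auto
      also have "\<dots> = \<delta> * (M / 2) powr (1 - \<alpha>) / (M - M / 2) * (M / 2 * (1 - \<epsilon>))"
      proof -
        have "(M / 2) powr (1 - \<alpha>) = M / 2 * (M / 2) powr (-\<alpha>)"
          using M powr_add[of "M / 2" 1 "-\<alpha>"] by simp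
        then show ?thesis using M by (simp add: field_simps)
      qed
      also have "\<dots> \<le> a x * (M / 2) powr (1 - \<alpha>) / (M - M / 2) * w t y"
        using ax \<delta> w_low[of t y] low_pos M
        by (intro mult_mono divide_right_mono mult_right_mono) auto
      finally have 3: "M / 2 * \<epsilon> * (2 / s) + M / 2 * \<epsilon> * (2 * speed M / \<xi>)
          \<le> a x * (M / 2) powr (1 - \<alpha>) / (M - M / 2) * w t y" by (simp add: algebra_simps)
      show ?thesis using 1 2 3 unfolding y_def by linarith
    qed
    show "AE z in strip T. 0 < \<theta> (fst z) (arc_coord \<sigma> b (snd z)) \<longrightarrow>
        (\<forall>c. speed (M / 2) \<le> c \<longrightarrow> c \<le> speed M \<longrightarrow>
          \<theta>t (fst z) (arc_coord \<sigma> b (snd z)) + c * \<theta>y (fst z) (arc_coord \<sigma> b (snd z)) \<le> 0)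
        \<or> U z \<le> M / 2 + w (fst z) (arc_coord \<sigma> b (snd z))"
      using hyp'
    proof eventually_elim
      case (elim z)
      define t y where "t = fst z" and "y = arc_coord \<sigma> b (snd z)"
      show ?case unfolding t_def[symmetric] y_def[symmetric]
      proof (intro impI)
        assume pos: "0 < \<theta> t y"
        then have UM: "U z \<le> M" using elim unfolding t_def y_def by simp
        show "(\<forall>c. speed (M / 2) \<le> c \<longrightarrow> c \<le> speed M \<longrightarrow> \<theta>t t y + c * \<theta>y t y \<le> 0)
          \<or> U z \<le> M / 2 + w t y"
        proof (cases "t \<le> t0 + s \<or> y \<le> y0 + \<xi>")
          case True
          then have "(t - t0 - s) / s \<le> 0 \<or> (y - y0 - \<xi>) / \<xi> \<le> 0"
            using scales by (auto simp: divide_le_0_iff)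
          then have "w t y = M / 2" unfolding w_def using smooth_step_eq_0 by auto
          then show ?thesis using UM by simp
        next
          case False
          then have "smooth_step' ((t - t0) / s) = 0" "smooth_step' ((y - y0) / \<xi>) = 0"
            using scales by (auto intro!: smooth_step'_eq_0 simp: pos_le_divide_eq)
          then have "\<theta>t t y = 0" "\<theta>y t y \<le> 0" unfolding \<theta>t_def \<theta>y_def using sb by auto
          then show ?thesis using sM by (auto intro!: mult_nonneg_nonpos)
        qed
      qed
    qed
  qed (use M hyp' \<theta>_nonneg in auto)
  then show "AE z in strip T. t0 + 2 * s < fst z \<longrightarrow> arc_coord \<sigma> b (snd z) \<in> {y0 + 2 * \<xi><..<\<rho>} \<longrightarrow>
      U z \<le> (1 - \<epsilon> / 2) * M"
  proof eventually_elim
    case (elim z)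
    define t y where "t = fst z" and "y = arc_coord \<sigma> b (snd z)"
    show ?case unfolding t_def[symmetric] y_def[symmetric]
    proof (intro impI)
      assume t: "t0 + 2 * s < t" and y: "y \<in> {y0 + 2 * \<xi><..<\<rho>}"
      have "smooth_step ((t - t0 - s) / s) = 1" "smooth_step ((y - y0 - \<xi>) / \<xi>) = 1"
        using t y scales by (auto intro!: smooth_step_eq_1 simp: pos_le_divide_eq)
      then have "w t y = M / 2 * (1 - \<epsilon>)" unfolding w_def by simp
      moreover have "U z \<le> M / 2 + w t y"
        using elim t y scales unfolding t_def[symmetric] y_def[symmetric] \<theta>_pos_iff by auto
      ultimately show "U z \<le> (1 - \<epsilon> / 2) * M" by (simp add: algebra_simps)
    qed
  qed
qed

text \<open>
  The barrier is a front of height \<open>\<epsilon> M / 2\<close> that leaves \<open>y = 0\<close> and moves at \<open>speed (M / 2)\<close>, the smallest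
  speed of all values above the level \<open>k = M / 2\<close>; it is a supersolution even where there is no
  damping.  Near \<open>y = 0\<close> the bound behind the front is supplied by the assumption \<open>inflow\<close>.
\<close>

lemma transport_step:
  assumes t0: "0 \<le> t0" and d: "0 < d" and M: "0 < M" "M \<le> K"
    and r: "0 < r" and \<epsilon>: "0 < \<epsilon>" "\<epsilon> < 1"
    and inflow: "le_after t0 b {0<..<d} ((1 - \<epsilon> / 2) * M)"
    and hyp: "le_after t0 b {0<..<1} M"
  shows "le_after (t0 + 2 * r + 1 / speed (M / 2)) b {0<..<1} ((1 - \<epsilon> / 2) * M)"
  unfolding le_after_def
proof (intro allI impI)
  fix T :: real assume T: "0 < T"
  define v where "v = speed (M / 2)"
  have "0 < c0 * (M / 2)" using c0 M by simp
  then have v: "0 < v" unfolding v_def using speed_lower[of "M / 2"] M by linarith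
  define \<theta> where "\<theta> t y = smooth_step ((t - t0) / r) * smooth_step (y / d) * pos_sq (1 - y)" for t y
  define \<theta>t where "\<theta>t t y = smooth_step' ((t - t0) / r) / r * smooth_step (y / d) * pos_sq (1 - y)" for t y
  define \<theta>y where "\<theta>y t y = smooth_step ((t - t0) / r) * (smooth_step' (y / d) / d * pos_sq (1 - y)
      - smooth_step (y / d) * (2 * max 0 (1 - y)))" for t y
  define w where "w t y = M / 2 * (1 - \<epsilon> * smooth_step ((t - t0 - r - y / v) / r))" for t y
  define wt where "wt t y = - (M / 2 * \<epsilon> * (smooth_step' ((t - t0 - r - y / v) / r) / r))" for t y
  define wy where "wy t y = M / 2 * \<epsilon> * (smooth_step' ((t - t0 - r - y / v) / r) / r) / v" for t y
  note sb = smooth_step_bounds smooth_step'_bounds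
  have nz: "r \<noteq> 0" "d \<noteq> 0" "v \<noteq> 0" using r d v by auto
  have \<theta>_pos_iff: "0 < \<theta> t y \<longleftrightarrow> t0 < t \<and> 0 < y \<and> y < 1" for t y
  proof
    assume "0 < \<theta> t y"
    then have "smooth_step ((t - t0) / r) \<noteq> 0" "smooth_step (y / d) \<noteq> 0" "pos_sq (1 - y) \<noteq> 0"
      unfolding \<theta>_def by auto
    then have "\<not> (t - t0) / r \<le> 0" "\<not> y / d \<le> 0" "\<not> 1 - y \<le> 0"
      using smooth_step_eq_0 by (auto simp: pos_sq_def max_def split: if_splits)
    then show "t0 < t \<and> 0 < y \<and> y < 1" using r d by (auto simp: divide_le_0_iff)
  next
    assume "t0 < t \<and> 0 < y \<and> y < 1"
    then show "0 < \<theta> t y" unfolding \<theta>_def using r d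
      by (intro mult_pos_pos smooth_step_pos divide_pos_pos) (auto simp: pos_sq_def)
  qed
  have \<theta>_nonneg: "0 \<le> \<theta> t y" for t y
    unfolding \<theta>_def using sb by (intro mult_nonneg_nonneg) (auto simp: pos_sq_def)
  have \<theta>_zero: "\<theta> t y = 0" if "t \<le> t0 \<or> y \<le> 0 \<or> 1 \<le> y" for t y
    using \<theta>_pos_iff[of t y] \<theta>_nonneg[of t y] that by linarith
  have w_low: "M / 2 * (1 - \<epsilon>) \<le> w t y" for t y
    unfolding w_def using M \<epsilon> sb by (intro mult_left_mono) auto
  have low_pos: "0 < M / 2 * (1 - \<epsilon>)" using M \<epsilon> by simp
  have hyp': "AE z in strip T. 0 < \<theta> (fst z) (arc_coord \<sigma> b (snd z)) \<longrightarrow> U z \<le> M"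
    using le_afterD[OF hyp T] by eventually_elim (auto simp: \<theta>_pos_iff)
  have "AE z in strip T. 0 < \<theta> (fst z) (arc_coord \<sigma> b (snd z)) \<longrightarrow>
      U z \<le> M / 2 + w (fst z) (arc_coord \<sigma> b (snd z))"
  proof (rule comparison[OF T, where k="M / 2" and M=M and \<theta>t=\<theta>t and \<theta>y=\<theta>y and wt=wt and wy=wy])
    show "((\<lambda>s. \<theta> s y) has_real_derivative \<theta>t t y) (at t)" for t y
      unfolding \<theta>_def \<theta>t_def by (auto intro!: derivative_eq_intros simp: nz field_simps)
    show "(\<theta> t has_real_derivative \<theta>y t y) (at y)" for t y
      unfolding \<theta>_def \<theta>y_def by (auto intro!: derivative_eq_intros simp: nz field_simps)
    show "((\<lambda>s. w s y) has_real_derivative wt t y) (at t)" for t y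
      unfolding w_def wt_def by (auto intro!: derivative_eq_intros simp: nz field_simps)
    show "(w t has_real_derivative wy t y) (at y)" for t y
      unfolding w_def wy_def by (auto intro!: derivative_eq_intros simp: nz field_simps)
    show "continuous_on UNIV (\<lambda>(t, y). \<theta> t y)" "continuous_on UNIV (\<lambda>(t, y). \<theta>t t y)"
      "continuous_on UNIV (\<lambda>(t, y). \<theta>y t y)" "continuous_on UNIV (\<lambda>(t, y). w t y)"
      "continuous_on UNIV (\<lambda>(t, y). wt t y)" "continuous_on UNIV (\<lambda>(t, y). wy t y)"
      unfolding \<theta>_def \<theta>t_def \<theta>y_def w_def wt_def wy_def case_prod_unfold divide_inverse
      by (intro continuous_intros)+
    show "\<theta> t y = 0" if "y \<notin> {0<..<1}" for t y
      using that by (intro \<theta>_zero) auto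
    show "\<theta> 0 y = 0" for y using t0 by (intro \<theta>_zero) auto
    show "0 < w t y" for t y using w_low[of t y] low_pos by linarith
    show "0 \<le> wt t (arc_coord \<sigma> b x) + c * wy t (arc_coord \<sigma> b x)
           + a x * (M / 2) powr (1 - \<alpha>) / (M - M / 2) * w t (arc_coord \<sigma> b x)"
      if "speed (M / 2) \<le> c" for t x c
    proof -
      define y where "y = arc_coord \<sigma> b x"
      have "wt t y + c * wy t y = M / 2 * \<epsilon> * (smooth_step' ((t - t0 - r - y / v) / r) / r) * (c / v - 1)"
      proof -
        have "- A + c * (A / v) = A * (c / v - 1)" for A by (simp add: algebra_simps)
        then show ?thesis unfolding wt_def wy_def .
      qed
      also have "\<dots> \<ge> 0" using that M \<epsilon> r v sb unfolding v_def[symmetric]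
        by (intro mult_nonneg_nonneg divide_nonneg_pos) auto
      moreover have "0 \<le> a x * (M / 2) powr (1 - \<alpha>) / (M - M / 2) * w t y"
        using a_nonneg[of x] M w_low[of t y] low_pos by (intro mult_nonneg_nonneg divide_nonneg_pos) auto
      ultimately show ?thesis unfolding y_def by linarith
    qed
    show "AE z in strip T. 0 < \<theta> (fst z) (arc_coord \<sigma> b (snd z)) \<longrightarrow>
        (\<forall>c. speed (M / 2) \<le> c \<longrightarrow> c \<le> speed M \<longrightarrow>
          \<theta>t (fst z) (arc_coord \<sigma> b (snd z)) + c * \<theta>y (fst z) (arc_coord \<sigma> b (snd z)) \<le> 0)
        \<or> U z \<le> M / 2 + w (fst z) (arc_coord \<sigma> b (snd z))"
      using hyp' le_afterD[OF inflow T]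
    proof eventually_elim
      case (elim z)
      define t y where "t = fst z" and "y = arc_coord \<sigma> b (snd z)"
      show ?case unfolding t_def[symmetric] y_def[symmetric]
      proof (intro impI)
        assume pos: "0 < \<theta> t y"
        then have UM: "U z \<le> M" using elim unfolding t_def y_def by simp
        have ty: "t0 < t" "0 < y" "y < 1" using pos \<theta>_pos_iff by auto
        consider "y < d" | "d \<le> y" "t \<le> t0 + r" | "d \<le> y" "t0 + r < t" by linarith
        then show "(\<forall>c. speed (M / 2) \<le> c \<longrightarrow> c \<le> speed M \<longrightarrow> \<theta>t t y + c * \<theta>y t y \<le> 0)
          \<or> U z \<le> M / 2 + w t y"
        proof cases
          case 1
          then have "U z \<le> (1 - \<epsilon> / 2) * M" using elim(2) ty unfolding t_def y_def by auto
          then show ?thesis using w_low[of t y] by (simp add: algebra_simps)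
        next
          case 2
          have "0 \<le> y / v" using ty v by simp
          then have "(t - t0 - r - y / v) / r \<le> 0" using r 2 by (auto simp: divide_le_0_iff)
          then have "w t y = M / 2" unfolding w_def using smooth_step_eq_0 by auto
          then show ?thesis using UM by simp
        next
          case 3
          then have "smooth_step' ((t - t0) / r) = 0" "smooth_step' (y / d) = 0"
            using r d by (auto intro!: smooth_step'_eq_0 simp: pos_le_divide_eq)
          then have "\<theta>t t y = 0" "\<theta>y t y \<le> 0" unfolding \<theta>t_def \<theta>y_def using sb by auto
          then show ?thesis using v unfolding v_def by (auto intro!: mult_nonneg_nonpos)
        qed
      qed
    qed
  qed (use M hyp' \<theta>_nonneg in auto)
  then show "AE z in strip T. t0 + 2 * r + 1 / speed (M / 2) < fst z \<longrightarrow> arc_coord \<sigma> b (snd z) \<in> {0<..<1} \<longrightarrow>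
      U z \<le> (1 - \<epsilon> / 2) * M"
  proof eventually_elim
    case (elim z)
    define t y where "t = fst z" and "y = arc_coord \<sigma> b (snd z)"
    show ?case unfolding t_def[symmetric] y_def[symmetric] v_def[symmetric]
    proof (intro impI)
      assume t: "t0 + 2 * r + 1 / v < t" and y: "y \<in> {0<..<1}"
      have "y / v \<le> 1 / v" using y v by (intro divide_right_mono) auto
      then have "smooth_step ((t - t0 - r - y / v) / r) = 1"
        using t r by (auto intro!: smooth_step_eq_1 simp: pos_le_divide_eq)
      then have "w t y = M / 2 * (1 - \<epsilon>)" unfolding w_def by simp
      moreover have "0 < 1 / v" using v by simp
      then have "t0 < t" using t r by linarith
      then have "U z \<le> M / 2 + w t y"
        using elim y unfolding t_def[symmetric] y_def[symmetric] \<theta>_pos_iff by auto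
      ultimately show "U z \<le> (1 - \<epsilon> / 2) * M" by (simp add: algebra_simps)
    qed
  qed
qed

end

section \<open>Decay and extinction\<close>

lemma AE_lborel_ex_in_interval:
  fixes s s' :: real
  assumes "AE x in lborel. P x" "s < s'"
  shows "\<exists>x\<in>{s<..<s'}. P x"
proof (rule ccontr)
  assume "\<not> ?thesis"
  then have "AE x in lborel. x \<notin> {s<..<s'}" using assms(1) by (auto elim!: eventually_mono)
  then have "{s<..<s'} \<in> null_sets lborel" by (subst AE_iff_null_sets) auto
  then show False using assms(2) by (simp add: null_sets_def)
qed

context one_sided_solution
begin

lemma le_after_shift:
  assumes e: "0 \<le> e" "e + d \<le> 1" and "le_after t b {e<..<e + d} M"
  shows "le_after t (b + \<sigma> * e) {0<..<d} M"
  unfolding le_after_def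
proof (intro allI impI)
  fix T :: real assume "0 < T"
  from le_afterD[OF assms(3) this]
  show "AE z in strip T. t < fst z \<longrightarrow> arc_coord \<sigma> (b + \<sigma> * e) (snd z) \<in> {0<..<d} \<longrightarrow> U z \<le> M"
  proof eventually_elim
    case (elim z)
    show ?case
    proof (intro impI)
      assume t: "t < fst z" and in_d: "arc_coord \<sigma> (b + \<sigma> * e) (snd z) \<in> {0<..<d}"
      then have "arc_coord \<sigma> b (snd z) = e + arc_coord \<sigma> (b + \<sigma> * e) (snd z)"
        using e by (intro arc_coord_shift[OF \<sigma>]) auto
      then show "U z \<le> M" using elim t in_d by auto
    qed
  qed
qed

lemma c1_pos: "0 < c1"
proof -
  have "c0 * K \<le> c1 * K" using speed_lower[of K] speed_upper[of K] K by linarith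
  then show ?thesis using c0 K by simp
qed

text \<open>
  \<open>damping_step\<close> with time scale \<open>1 / M\<close> and length scale \<open>\<rho> / 8\<close> lowers the bound on \<open>(\<rho> / 4, \<rho>)\<close>, and
  \<open>transport_step\<close>, started at \<open>\<rho> / 4\<close>, carries it around the circle in a further time of order \<open>1 / M\<close>.
  For \<open>M \<le> K\<close> the same \<open>\<epsilon>\<close> works, because the relative slope of the barrier is of order \<open>\<epsilon> M\<close> whereas the
  relative damping is of order \<open>M powr (-\<alpha>)\<close>.
\<close>

lemma contraction:
  assumes \<rho>: "0 < \<rho>" "\<rho> \<le> 1" and \<delta>: "0 < \<delta>"
    and damped: "\<And>x. arc_coord \<sigma> b x \<in> {0<..<\<rho>} \<Longrightarrow> \<delta> \<le> a x"
  obtains \<epsilon> C where "0 < \<epsilon>" "\<epsilon> < 1" "0 < C"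
    "\<And>M t. 0 < M \<Longrightarrow> M \<le> K \<Longrightarrow> 0 \<le> t \<Longrightarrow> le_after t b {0<..<1} M \<Longrightarrow>
       le_after (t + C / M) b {0<..<1} ((1 - \<epsilon> / 2) * M)"
proof -
  define A where "A = 2 + 16 * c1 / \<rho>"
  have A: "0 < A" unfolding A_def using c1_pos \<rho> by (auto intro!: add_pos_nonneg)
  define \<epsilon> where "\<epsilon> = min (1 / 2) (\<delta> / (2 * A * K powr (1 + \<alpha>)))"
  have \<epsilon>: "0 < \<epsilon>" "\<epsilon> \<le> 1 / 2" unfolding \<epsilon>_def using \<delta> A K by auto
  show ?thesis
  proof (rule that[of \<epsilon> "4 + 2 / c0"])
    fix M t assume M: "0 < M" "M \<le> K" and t: "0 \<le> t" and hyp: "le_after t b {0<..<1} M"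
    have sp: "speed M \<le> c1 * M" using speed_upper M by simp
    have "\<epsilon> * (2 / (1 / M) + 2 * speed M / (\<rho> / 8)) \<le> \<epsilon> * (M * A)"
    proof -
      have "16 * speed M / \<rho> \<le> 16 * (c1 * M) / \<rho>" using sp \<rho> by (intro divide_right_mono) auto
      then show ?thesis using \<epsilon> unfolding A_def by (intro mult_left_mono) (auto simp: algebra_simps)
    qed
    also have "\<dots> = \<epsilon> * A * (M powr (1 + \<alpha>) * M powr (-\<alpha>))"
      using M by (simp add: powr_add[symmetric])
    also have "\<dots> \<le> \<epsilon> * A * (K powr (1 + \<alpha>) * M powr (-\<alpha>))"
      using M \<epsilon> A \<alpha> by (intro mult_left_mono mult_right_mono powr_mono2) auto
    also have "\<dots> = (\<epsilon> * (A * K powr (1 + \<alpha>))) * M powr (-\<alpha>)" by simp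
    also have "\<dots> \<le> (\<delta> / 2) * M powr (-\<alpha>)"
    proof (rule mult_right_mono)
      have "\<epsilon> \<le> \<delta> / (2 * A * K powr (1 + \<alpha>))" unfolding \<epsilon>_def by simp
      then show "\<epsilon> * (A * K powr (1 + \<alpha>)) \<le> \<delta> / 2" using A K by (simp add: field_simps)
    qed simp
    also have "\<dots> \<le> (\<delta> * (1 - \<epsilon>)) * (M / 2) powr (-\<alpha>)"
    proof (intro mult_mono powr_mono2')
      have "\<delta> * (1 / 2) \<le> \<delta> * (1 - \<epsilon>)" using \<epsilon> \<delta> by (intro mult_left_mono) auto
      then show "\<delta> / 2 \<le> \<delta> * (1 - \<epsilon>)" by simp
    qed (use M \<alpha> \<epsilon> \<delta> in auto)
    finally have small: "\<epsilon> * (2 / (1 / M) + 2 * speed M / (\<rho> / 8)) \<le> \<delta> * (1 - \<epsilon>) * (M / 2) powr (-\<alpha>)" .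
    have "le_after (t + 2 * (1 / M)) b {0 + 2 * (\<rho> / 8)<..<\<rho>} ((1 - \<epsilon> / 2) * M)"
      using M \<epsilon> \<rho> \<delta> t small
      by (intro damping_step le_after_weaken[OF hyp]) (auto intro: damped)
    then have "le_after (t + 2 / M) b {\<rho> / 4<..<\<rho> / 4 + 3 / 4 * \<rho>} ((1 - \<epsilon> / 2) * M)"
      by (rule le_after_weaken) auto
    then have "le_after (t + 2 / M) (b + \<sigma> * (\<rho> / 4)) {0<..<3 / 4 * \<rho>} ((1 - \<epsilon> / 2) * M)"
      using \<rho> by (intro le_after_shift) auto
    then have "le_after (t + 2 / M + 2 * (1 / M) + 1 / speed (M / 2)) (b + \<sigma> * (\<rho> / 4)) {0<..<1} ((1 - \<epsilon> / 2) * M)"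
      using M \<epsilon> \<rho> t le_after_weaken[OF le_after_full_circle[OF hyp], of "t + 2 / M" _ "{0<..<1}" M]
      by (intro transport_step[where d="3 / 4 * \<rho>"]) auto
    then have "le_after (t + 2 / M + 2 * (1 / M) + 1 / speed (M / 2)) b {0<..<1} ((1 - \<epsilon> / 2) * M)"
      by (rule le_after_full_circle)
    moreover have "0 < c0 * (M / 2)" using M c0 by simp
    then have "1 / speed (M / 2) \<le> 1 / (c0 * (M / 2))"
      using speed_lower[of "M / 2"] M by (intro frac_le) auto
    then have "t + 2 / M + 2 * (1 / M) + 1 / speed (M / 2) \<le> t + (4 + 2 / c0) / M"
      using c0 M by (simp add: add_divide_distrib)
    ultimately show "le_after (t + (4 + 2 / c0) / M) b {0<..<1} ((1 - \<epsilon> / 2) * M)"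
      by (rule le_after_weaken) auto
  qed (use \<epsilon> c0 in \<open>auto intro!: add_pos_nonneg\<close>)
qed

text \<open>
  With \<open>M n = K q^n\<close>, the bound \<open>M n\<close> holds after the time \<open>C / M 0 + \<dots> + C / M (n - 1) \<le> D / M n\<close>.
\<close>

lemma decay:
  assumes \<rho>: "0 < \<rho>" "\<rho> \<le> 1" and \<delta>: "0 < \<delta>"
    and damped: "\<And>x. arc_coord \<sigma> b x \<in> {0<..<\<rho>} \<Longrightarrow> \<delta> \<le> a x"
  obtains C where "0 < C" "\<And>t b' I. 0 < t \<Longrightarrow> le_after t b' I (C / t)"
proof -
  obtain \<epsilon> C where \<epsilon>: "0 < \<epsilon>" "\<epsilon> < 1" and C: "0 < C"
    and step: "\<And>M t. 0 < M \<Longrightarrow> M \<le> K \<Longrightarrow> 0 \<le> t \<Longrightarrow> le_after t b {0<..<1} M \<Longrightarrow>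
       le_after (t + C / M) b {0<..<1} ((1 - \<epsilon> / 2) * M)"
    by (rule contraction[OF \<rho> \<delta> damped], assumption, rule that)
  define q where "q = 1 - \<epsilon> / 2"
  have q: "0 < q" "q < 1" unfolding q_def using \<epsilon> by auto
  define D where "D = C / (1 - q)"
  have D: "0 < D" unfolding D_def using C q by simp
  define M where "M n = K * q ^ n" for n
  have M: "0 < M n" "M n \<le> K" for n
    unfolding M_def using K q by (auto intro!: mult_left_le power_le_one)
  have all: "le_after (D / M n) b {0<..<1} (M n)" for n
  proof (induction n)
    case 0
    show ?case unfolding le_after_def
    proof (intro allI impI)
      fix T :: real assume "0 < T"
      from maximum_principle[OF this]
      show "AE z in strip T. D / M 0 < fst z \<longrightarrow> arc_coord \<sigma> b (snd z) \<in> {0<..<1} \<longrightarrow> U z \<le> M 0"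
        by eventually_elim (simp add: M_def)
    qed
  next
    case (Suc n)
    have "le_after (D / M n + C / M n) b {0<..<1} ((1 - \<epsilon> / 2) * M n)"
      using D M[of n] by (intro step Suc) auto
    moreover have "(1 - \<epsilon> / 2) * M n = M (Suc n)" unfolding M_def q_def by simp
    moreover have "D / M n + C / M n \<le> D / M (Suc n)"
    proof -
      have "C \<le> C / q" using C q by (simp add: pos_le_divide_eq mult_left_le)
      moreover have "C = D * (1 - q)" unfolding D_def using q by simp
      then have "D / q = D + C / q" using q by (simp add: field_simps)
      ultimately have "D + C \<le> D / q" by simp
      then have "(D + C) / M n \<le> D / q / M n" using M[of n] by (intro divide_right_mono) auto
      then show ?thesis unfolding M_def by (simp add: add_divide_distrib mult_ac)
    qed
    ultimately show ?case using le_after_weaken by (metis order_refl)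
  qed
  show ?thesis
  proof (rule that[of "D / q"])
    fix t :: real and b' I assume t: "0 < t"
    obtain m where "q ^ m < D / (t * K)"
      using real_arch_pow_inv[of "D / (t * K)" q] q D t K by auto
    then have "M m < D / t" unfolding M_def using K t by (simp add: field_simps)
    \<comment> \<open>For the first \<open>n\<close> with \<open>M n < D / t\<close>, the bound \<open>M (n - 1) = M n / q\<close> is already in force at time \<open>t\<close>.\<close>
    define n where "n = (LEAST n. M n < D / t)"
    have n: "M n < D / t" unfolding n_def by (rule LeastI) fact
    have "le_after t b {0<..<1} (D / q / t)"
    proof (cases n)
      case 0
      have "D / t \<le> D / q / t" using D q t by (intro divide_right_mono) (auto simp: field_simps)
      then have KD: "K \<le> D / q / t" using n unfolding 0 M_def by simp
      show ?thesis unfolding le_after_def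
      proof (intro allI impI)
        fix T :: real assume "0 < T"
        from maximum_principle[OF this]
        show "AE z in strip T. t < fst z \<longrightarrow> arc_coord \<sigma> b (snd z) \<in> {0<..<1} \<longrightarrow> U z \<le> D / q / t"
          by eventually_elim (use KD in auto)
      qed
    next
      case (Suc j)
      have "\<not> M j < D / t" using not_less_Least[of j "\<lambda>n. M n < D / t"] Suc unfolding n_def by simp
      then have "D / M j \<le> t" using M[of j] t by (simp add: field_simps)
      moreover have "M j \<le> D / q / t"
      proof -
        have "M n = q * M j" unfolding Suc M_def by simp
        then show ?thesis using n q t by (simp add: field_simps)
      qed
      ultimately show ?thesis using le_after_weaken[OF all[of j]] by simp
    qed
    then show "le_after t b' I (D / q / t)" by (rule le_after_full_circle)
  qed (use D q in simp)
qed

text \<open>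
  Each application of \<open>damping_step\<close> with \<open>\<epsilon> = 1/2\<close> multiplies the bound \<open>M\<close> by \<open>3/4\<close> and costs a time of
  order \<open>M powr \<alpha>\<close> and a length of order \<open>M powr (1 + \<alpha>)\<close>.  Both series converge, so after finite time
  and length all the bounds \<open>(3/4)^n M\<close> hold at once.
\<close>

lemma extinction:
  assumes \<rho>: "\<rho> \<le> 1" and \<delta>: "0 < \<delta>"
    and damped: "\<And>x. arc_coord \<sigma> b x \<in> {0<..<\<rho>} \<Longrightarrow> \<delta> \<le> a x"
  obtains P Q where "0 < P" "0 < Q"
    "\<And>M t. 0 < M \<Longrightarrow> M \<le> K \<Longrightarrow> 0 \<le> t \<Longrightarrow> le_after t b {0<..<\<rho>} M \<Longrightarrow>
       le_after (t + P * M powr \<alpha>) b {Q * M powr (1 + \<alpha>)<..<\<rho>} 0"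
proof -
  define l :: real where "l = 3 / 4"
  define \<mu> \<nu> where "\<mu> = l powr \<alpha>" and "\<nu> = l powr (1 + \<alpha>)"
  have \<mu>: "0 < \<mu>" "\<mu> < 1" and \<nu>: "0 < \<nu>" "\<nu> < 1"
    using \<alpha> powr_less_mono2[of \<alpha> l 1] powr_less_mono2[of "1 + \<alpha>" l 1]
    unfolding \<mu>_def \<nu>_def l_def by auto
  define P Q where "P = 8 / \<delta> / (1 - \<mu>)" and "Q = 8 * c1 / \<delta> / (1 - \<nu>)"
  have PQ: "0 < P" "0 < Q" unfolding P_def Q_def using \<delta> \<mu> \<nu> c1_pos by auto
  have step: "le_after (t + 8 / \<delta> * M powr \<alpha>) b {y + 8 * c1 / \<delta> * M powr (1 + \<alpha>)<..<\<rho>} (l * M)"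
    if M: "0 < M" "M \<le> K" and t: "0 \<le> t" "0 \<le> y" and hyp: "le_after t b {y<..<\<rho>} M" for M t y
  proof -
    define s \<xi> where "s = 4 / \<delta> * M powr \<alpha>" and "\<xi> = 4 * c1 / \<delta> * M powr (1 + \<alpha>)"
    have s: "0 < s" "0 < \<xi>" unfolding s_def \<xi>_def using M \<delta> c1_pos by auto
    have "2 / s = \<delta> / 2 * M powr (-\<alpha>)" unfolding s_def using M \<delta> by (simp add: powr_minus field_simps)
    moreover have "2 * speed M / \<xi> \<le> \<delta> / 2 * M powr (-\<alpha>)"
    proof -
      have "2 * speed M / \<xi> \<le> 2 * (c1 * M) / \<xi>" using speed_upper[of M] M s by (intro divide_right_mono) auto
      also have "\<dots> = \<delta> / 2 * M powr (-\<alpha>)"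
        unfolding \<xi>_def powr_add using M \<delta> c1_pos by (simp add: powr_minus field_simps)
      finally show ?thesis .
    qed
    ultimately have "2 / s + 2 * speed M / \<xi> \<le> \<delta> * M powr (-\<alpha>)" by simp
    also have "\<dots> \<le> \<delta> * (M / 2) powr (-\<alpha>)" using M \<delta> \<alpha> by (intro mult_left_mono powr_mono2') auto
    finally have small: "1 / 2 * (2 / s + 2 * speed M / \<xi>) \<le> \<delta> * (1 - 1 / 2) * (M / 2) powr (-\<alpha>)" by simp
    have "le_after (t + 2 * s) b {y + 2 * \<xi><..<\<rho>} ((1 - 1 / 2 / 2) * M)"
      using M s small t \<rho> \<delta> hyp by (intro damping_step) (auto intro: damped)
    then show ?thesis unfolding s_def \<xi>_def l_def by (simp add: mult.assoc)
  qed
  show ?thesis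
  proof (rule that[OF PQ])
    fix M t assume M: "0 < M" "M \<le> K" and t: "0 \<le> t" and hyp: "le_after t b {0<..<\<rho>} M"
    have Mn: "0 < l ^ n * M" "l ^ n * M \<le> K" for n
    proof -
      show "0 < l ^ n * M" unfolding l_def using M by simp
      have "l ^ n * M \<le> 1 * M" unfolding l_def using M by (intro mult_right_mono power_le_one) auto
      then show "l ^ n * M \<le> K" using M by linarith
    qed
    have pw: "(l ^ n * M) powr x = (l powr x) ^ n * M powr x" for n x
    proof -
      have "(l ^ n * M) powr x = (l ^ n) powr x * M powr x" unfolding l_def using M by (simp add: powr_mult)
      also have "(l ^ n) powr x = (l powr x) ^ n"
      proof (induction n)
        case (Suc n)
        have "0 \<le> l" unfolding l_def by simp
        then show ?case using Suc by (simp add: powr_mult)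
      qed (simp add: l_def)
      finally show ?thesis .
    qed
    have it: "le_after (t + P * (1 - \<mu> ^ n) * M powr \<alpha>) b {Q * (1 - \<nu> ^ n) * M powr (1 + \<alpha>)<..<\<rho>} (l ^ n * M)" for n
    proof (induction n)
      case 0
      then show ?case using hyp by simp
    next
      case (Suc n)
      have nn: "\<mu> ^ n \<le> 1" "\<nu> ^ n \<le> 1" using \<mu> \<nu> by (auto intro!: power_le_one)
      have A1: "le_after (t + P * (1 - \<mu> ^ n) * M powr \<alpha> + 8 / \<delta> * (l ^ n * M) powr \<alpha>) b
         {Q * (1 - \<nu> ^ n) * M powr (1 + \<alpha>) + 8 * c1 / \<delta> * (l ^ n * M) powr (1 + \<alpha>)<..<\<rho>} (l * (l ^ n * M))"
        using t PQ nn by (intro step Mn Suc) auto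
      have A2: "t + P * (1 - \<mu> ^ n) * M powr \<alpha> + 8 / \<delta> * (l ^ n * M) powr \<alpha>
         = t + P * (1 - \<mu> ^ Suc n) * M powr \<alpha>"
      proof -
        have "P * (1 - \<mu>) = 8 / \<delta>"
          by (rule nonzero_eq_divide_eq[THEN iffD1]) (use \<mu> in \<open>auto simp: P_def\<close>)
        note eq = this[symmetric]
        show ?thesis unfolding pw \<mu>_def[symmetric] eq by (simp add: algebra_simps)
      qed
      have A3: "Q * (1 - \<nu> ^ n) * M powr (1 + \<alpha>) + 8 * c1 / \<delta> * (l ^ n * M) powr (1 + \<alpha>)
         = Q * (1 - \<nu> ^ Suc n) * M powr (1 + \<alpha>)"
      proof -
        have "Q * (1 - \<nu>) = 8 * c1 / \<delta>"
          by (rule nonzero_eq_divide_eq[THEN iffD1]) (use \<nu> in \<open>auto simp: Q_def\<close>)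
        note eq = this[symmetric]
        show ?thesis unfolding pw \<nu>_def[symmetric] eq by (simp add: algebra_simps)
      qed
      have A4: "l * (l ^ n * M) = l ^ Suc n * M" by simp
      show ?case using A1 unfolding A2 A3 A4 .
    qed
    have it': "le_after (t + P * M powr \<alpha>) b {Q * M powr (1 + \<alpha>)<..<\<rho>} (l ^ n * M)" for n
    proof (rule le_after_weaken[OF it[of n]])
      have "P * (1 - \<mu> ^ n) * M powr \<alpha> \<le> P * 1 * M powr \<alpha>"
        using PQ \<mu> by (intro mult_right_mono mult_left_mono) auto
      then show "t + P * (1 - \<mu> ^ n) * M powr \<alpha> \<le> t + P * M powr \<alpha>" by simp
      have "Q * (1 - \<nu> ^ n) * M powr (1 + \<alpha>) \<le> Q * 1 * M powr (1 + \<alpha>)"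
        using PQ \<nu> by (intro mult_right_mono mult_left_mono) auto
      then show "{Q * M powr (1 + \<alpha>)<..<\<rho>} \<subseteq> {Q * (1 - \<nu> ^ n) * M powr (1 + \<alpha>)<..<\<rho>}" by auto
    qed simp
    show "le_after (t + P * M powr \<alpha>) b {Q * M powr (1 + \<alpha>)<..<\<rho>} 0"
      unfolding le_after_def
    proof (intro allI impI)
      fix T :: real assume T: "0 < T"
      have "AE z in strip T. \<forall>n. t + P * M powr \<alpha> < fst z \<longrightarrow>
          arc_coord \<sigma> b (snd z) \<in> {Q * M powr (1 + \<alpha>)<..<\<rho>} \<longrightarrow> U z \<le> l ^ n * M"
        unfolding AE_all_countable using le_afterD[OF it' T] by blast
      then show "AE z in strip T. t + P * M powr \<alpha> < fst z \<longrightarrow>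
          arc_coord \<sigma> b (snd z) \<in> {Q * M powr (1 + \<alpha>)<..<\<rho>} \<longrightarrow> U z \<le> 0"
      proof eventually_elim
        case (elim z)
        have "(\<lambda>n. l ^ n * M) \<longlonglongrightarrow> 0 * M" unfolding l_def by (intro tendsto_intros LIMSEQ_realpow_zero) auto
        then show ?case using elim by (auto intro: LIMSEQ_le_const)
      qed
    qed
  qed
qed

text \<open>
  At time \<open>t / 2\<close> the bound \<open>M = 2 D / t\<close> is available; for large \<open>t\<close> the remaining time \<open>t / 2\<close> exceeds
  the extinction time \<open>P M powr \<alpha>\<close>, which leaves a boundary layer of width \<open>Q M powr (1 + \<alpha>)\<close>.
\<close>

lemma extinction_and_decay:
  assumes \<rho>: "0 < \<rho>" "\<rho> \<le> 1" and \<delta>: "0 < \<delta>"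
    and damped: "\<And>x. arc_coord \<sigma> b x \<in> {0<..<\<rho>} \<Longrightarrow> \<delta> \<le> a x"
  obtains C tstar where "0 < C" "0 < tstar"
    "\<And>t. tstar \<le> t \<Longrightarrow> le_after t b {C / t powr (1 + \<alpha>)<..<\<rho>} 0"
    "\<And>t. tstar \<le> t \<Longrightarrow> le_after t b UNIV (C / t)"
proof -
  obtain D where D: "0 < D" "\<And>t b' I. 0 < t \<Longrightarrow> le_after t b' I (D / t)"
    by (rule decay[OF \<rho> \<delta> damped], assumption, rule that)
  obtain P Q where PQ: "0 < P" "0 < Q"
    and ext: "\<And>M t. 0 < M \<Longrightarrow> M \<le> K \<Longrightarrow> 0 \<le> t \<Longrightarrow> le_after t b {0<..<\<rho>} M \<Longrightarrow>
       le_after (t + P * M powr \<alpha>) b {Q * M powr (1 + \<alpha>)<..<\<rho>} 0"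
    by (rule extinction[OF \<rho>(2) \<delta> damped], assumption, rule that)
  define C where "C = max D (Q * (2 * D) powr (1 + \<alpha>))"
  define tstar where "tstar = max (2 * D / K) (2 * P * K powr \<alpha>)"
  have tstar: "0 < tstar" unfolding tstar_def using D K by (auto simp: less_max_iff_disj)
  show ?thesis
  proof (rule that[OF _ tstar])
    show "0 < C" unfolding C_def using D by (auto simp: less_max_iff_disj)
    fix t assume t: "tstar \<le> t"
    then have t0: "0 < t" using tstar by simp
    have "D / t \<le> C / t" unfolding C_def using t0 by (intro divide_right_mono) auto
    then show "le_after t b UNIV (C / t)" using le_after_weaken[OF D(2)[OF t0, of b UNIV]] by simp
    define M where "M = 2 * D / t"
    have M: "0 < M" "M \<le> K"
      unfolding M_def using D t0 t K by (auto simp: tstar_def field_simps)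
    have "le_after (t / 2) b {0<..<\<rho>} M" unfolding M_def using D(2)[of "t / 2"] t0 by (simp add: mult.commute)
    then have "le_after (t / 2 + P * M powr \<alpha>) b {Q * M powr (1 + \<alpha>)<..<\<rho>} 0"
      using M t0 by (intro ext) auto
    then show "le_after t b {C / t powr (1 + \<alpha>)<..<\<rho>} 0"
    proof (rule le_after_weaken)
      have "P * M powr \<alpha> \<le> P * K powr \<alpha>" using M PQ \<alpha> by (intro mult_left_mono powr_mono2) auto
      also have "\<dots> \<le> t / 2" using t unfolding tstar_def by simp
      finally show "t / 2 + P * M powr \<alpha> \<le> t" by simp
      have "Q * M powr (1 + \<alpha>) = Q * (2 * D) powr (1 + \<alpha>) / t powr (1 + \<alpha>)"
        unfolding M_def using D t0 by (simp add: powr_divide)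
      also have "\<dots> \<le> C / t powr (1 + \<alpha>)" unfolding C_def by (intro divide_right_mono) auto
      finally show "{C / t powr (1 + \<alpha>)<..<\<rho>} \<subseteq> {Q * M powr (1 + \<alpha>)<..<\<rho>}" by auto
    qed simp
  qed
qed

text \<open>
  Almost every time slice satisfies the bound; such times accumulate at \<open>t\<close> from the right, and the
  excess of \<open>u t\<close> over the bound is at most the \<open>L\<^sup>1\<close> distance to these slices.
\<close>

lemma le_after_slice:
  assumes cont: "continuous_into_L1 u" and I: "I \<in> sets borel"
    and le: "le_after t0 b I M" and t: "0 \<le> t" "t0 \<le> t"
  shows "AE x in circ. arc_coord \<sigma> b x \<in> I \<longrightarrow> \<tau> * u t x \<le> M"
proof -
  define g where "g x = indicator {x. arc_coord \<sigma> b x \<in> I} x * max 0 (\<tau> * u t x - M)" for x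
  define d where "d s = (\<integral>x. \<bar>u s x - u t x\<bar> \<partial>circ)" for s
  have int: "integrable circ (u s)" if "0 \<le> s" for s
    using cont that unfolding continuous_into_L1_def by blast
  have lim: "(d \<longlongrightarrow> 0) (at t within {0..})"
    using cont t(1) unfolding continuous_into_L1_def d_def by blast
  have "AE s in lborel. s \<in> {0..t + 1} \<longrightarrow>
      (AE x in circ. t0 < s \<longrightarrow> arc_coord \<sigma> b x \<in> I \<longrightarrow> U (s, x) \<le> M)"
    using AE_strip_slice[OF le_afterD[OF le, of "t + 1"]] t by simp
  note ex = AE_lborel_ex_in_interval[OF this]
  define good where "good s \<longleftrightarrow> (s \<in> {0..t + 1} \<longrightarrow>
      (AE x in circ. t0 < s \<longrightarrow> arc_coord \<sigma> b x \<in> I \<longrightarrow> U (s, x) \<le> M))" for s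
  have "\<forall>n. \<exists>s. s \<in> {t<..<t + 1 / real (Suc n)} \<and> good s"
  proof
    fix n
    show "\<exists>s. s \<in> {t<..<t + 1 / real (Suc n)} \<and> good s"
      using ex[of t "t + 1 / real (Suc n)"] unfolding good_def by auto
  qed
  then obtain S where S': "\<And>n. S n \<in> {t<..<t + 1 / real (Suc n)} \<and> good (S n)"
    unfolding choice_iff by blast
  then have S: "\<And>n. S n \<in> {t<..<t + 1 / real (Suc n)}"
    "\<And>n. S n \<in> {0..t + 1} \<longrightarrow> (AE x in circ. t0 < S n \<longrightarrow> arc_coord \<sigma> b x \<in> I \<longrightarrow> U (S n, x) \<le> M)"
    unfolding good_def by blast+
  have S_in: "S n \<in> {0..t + 1}" "t < S n" for n
  proof -
    have "1 / real (Suc n) \<le> 1" by simp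
    moreover have "t < S n \<and> S n < t + 1 / real (Suc n)" using S(1)[of n] by (simp del: of_nat_Suc)
    ultimately have "t < S n \<and> S n \<le> t + 1" by linarith
    then show "S n \<in> {0..t + 1}" "t < S n" using t by auto
  qed
  have "S \<longlonglongrightarrow> t"
  proof (rule tendsto_sandwich[where f="\<lambda>n. t" and h="\<lambda>n. t + 1 / real (Suc n)"])
    show "(\<lambda>n. t + 1 / real (Suc n)) \<longlonglongrightarrow> t"
      using LIMSEQ_inverse_real_of_nat_add[of t] by (simp add: inverse_eq_divide)
  qed (use S(1) in \<open>auto intro!: always_eventually less_imp_le\<close>)
  then have "filterlim S (at t within {0..}) sequentially"
    using S_in by (auto simp: filterlim_at intro!: always_eventually)
  with lim have dlim: "(\<lambda>n. d (S n)) \<longlonglongrightarrow> 0" by (rule filterlim_compose)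
  have arc_m: "{x. arc_coord \<sigma> b x \<in> I} \<in> sets borel"
  proof -
    have "arc_coord \<sigma> b \<in> borel_measurable borel" unfolding arc_coord_def frac_def by measurable
    from measurable_sets[OF this I] show ?thesis by (simp add: vimage_def)
  qed
  have gm: "g \<in> borel_measurable circ"
  proof -
    have "(indicator {x. arc_coord \<sigma> b x \<in> I} :: real \<Rightarrow> real) \<in> borel_measurable circ"
      using arc_m by (intro measurable_restrict_space1 measurable_completion borel_measurable_indicator) auto
    then show ?thesis unfolding g_def using int[OF t(1)] by measurable
  qed
  have g_le: "AE x in circ. g x \<le> \<bar>u (S n) x - u t x\<bar>" for n
    using S(2)[of n, rule_format, OF S_in(1)]
  proof eventually_elim
    case (elim x)
    show ?case
    proof (cases "arc_coord \<sigma> b x \<in> I")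
      case True
      then have "\<tau> * u (S n) x \<le> M" using elim S_in(2)[of n] t unfolding U_def by auto
      then have "max 0 (\<tau> * u t x - M) \<le> \<bar>\<tau> * u t x - \<tau> * u (S n) x\<bar>" by auto
      also have "\<dots> = \<bar>u (S n) x - u t x\<bar>" using \<tau> by auto
      finally show ?thesis using True unfolding g_def by simp
    qed (simp add: g_def)
  qed
  have g0: "0 \<le> g x" for x unfolding g_def by simp
  have int_d: "integrable circ (\<lambda>x. \<bar>u (S n) x - u t x\<bar>)" for n
    using int S_in(1)[of n] t by (intro integrable_abs Bochner_Integration.integrable_diff) auto
  have gi: "integrable circ g"
    by (rule Bochner_Integration.integrable_bound[OF int_d[of 0] gm])
      (use g_le[of 0] in eventually_elim, use g0 in auto)
  have "(\<integral>x. g x \<partial>circ) \<le> d (S n)" for n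
    unfolding d_def by (rule integral_mono_AE[OF gi int_d g_le])
  then have "(\<integral>x. g x \<partial>circ) \<le> 0" using dlim by (intro LIMSEQ_le_const) auto
  moreover have "0 \<le> (\<integral>x. g x \<partial>circ)" using g0 by (intro Bochner_Integration.integral_nonneg) auto
  ultimately have "(\<integral>x. g x \<partial>circ) = 0" by linarith
  then have "AE x in circ. g x = 0"
    using integral_nonneg_eq_0_iff_AE[OF gi] g0 by auto
  then show ?thesis by eventually_elim (auto simp: g_def max_def split: if_splits)
qed

end

section \<open>Both signs together\<close>

text \<open>
  With \<open>\<sigma> = \<kappa> \<tau>\<close> the speed \<open>v \<mapsto> \<sigma> f'(\<tau> v)\<close> has the derivative \<open>\<kappa> f''(\<tau> v)\<close>, which lies in \<open>[c0, c1]\<close>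
  whatever the sign of \<open>\<tau>\<close>.
\<close>

lemma one_sided_solutionI:
  assumes \<alpha>: "\<alpha> \<in> {0<..1}" and f: "C_infinity f" and K: "0 < K" and f'0: "deriv f 0 = 0"
    and \<kappa>: "\<kappa> \<in> {1, -1}" and c0: "0 < c0"
    and f'': "\<And>s. s \<in> {-K..K} \<Longrightarrow> c0 \<le> \<kappa> * deriv (deriv f) s \<and> \<kappa> * deriv (deriv f) s \<le> c1"
    and a: "condition_A a" and u0: "Linfty_norm u0 \<le> ereal K"
    and u: "global_solution \<alpha> f a u0 u" and \<tau>: "\<tau> \<in> {1, -1}"
  shows "one_sided_solution \<alpha> K f a u0 u (\<kappa> * \<tau>) \<tau> c0 c1"
proof
  have \<tau>2: "\<tau> * \<tau> = 1" using \<tau> by auto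
  define s where "s v = \<kappa> * \<tau> * deriv f (\<tau> * v)" for v
  define s' where "s' v = \<kappa> * deriv (deriv f) (\<tau> * v)" for v
  have ds: "(s has_real_derivative s' v) (at v)" for v
  proof -
    have "((\<lambda>v. \<tau> * v) has_real_derivative \<tau>) (at v)" by (auto intro!: derivative_eq_intros)
    from DERIV_cmult[OF DERIV_chain2[OF C_infinity_has_deriv[OF C_infinity_deriv(2)[OF f]] this], of "\<kappa> * \<tau>"]
    have "(s has_real_derivative \<kappa> * \<tau> * (deriv (deriv f) (\<tau> * v) * \<tau>)) (at v)" unfolding s_def .
    moreover have "\<kappa> * \<tau> * (deriv (deriv f) (\<tau> * v) * \<tau>) = \<tau> * \<tau> * (\<kappa> * deriv (deriv f) (\<tau> * v))"
      by (simp only: mult_ac)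
    ultimately show ?thesis unfolding \<tau>2 s'_def by simp
  qed
  have s'b: "c0 \<le> s' v" "s' v \<le> c1" if "0 \<le> v" "v \<le> K" for v
    using f''[of "\<tau> * v"] that \<tau> unfolding s'_def by auto
  have s0: "s 0 = 0" unfolding s_def using f'0 by simp
  show "\<kappa> * \<tau> * deriv f (\<tau> * v) \<le> \<kappa> * \<tau> * deriv f (\<tau> * v')" if v: "0 \<le> v" "v \<le> v'" "v' \<le> K" for v v'
    unfolding s_def[symmetric]
  proof (rule DERIV_nonneg_imp_nondecreasing[OF v(2)])
    fix x assume "v \<le> x" "x \<le> v'"
    then show "\<exists>y. (s has_real_derivative y) (at x) \<and> 0 \<le> y"
      using ds[of x] s'b(1)[of x] v c0 by (intro exI[of _ "s' x"]) auto
  qed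
  show "c0 * v \<le> \<kappa> * \<tau> * deriv f (\<tau> * v) \<and> \<kappa> * \<tau> * deriv f (\<tau> * v) \<le> c1 * v" if v: "0 \<le> v" "v \<le> K" for v
    unfolding s_def[symmetric]
  proof
    have "s 0 - c0 * 0 \<le> s v - c0 * v"
    proof (rule DERIV_nonneg_imp_nondecreasing[OF v(1)])
      fix x assume "0 \<le> x" "x \<le> v"
      moreover have "((\<lambda>v. s v - c0 * v) has_real_derivative s' x - c0) (at x)"
        by (rule derivative_eq_intros ds refl | simp)+
      ultimately show "\<exists>y. ((\<lambda>v. s v - c0 * v) has_real_derivative y) (at x) \<and> 0 \<le> y"
        using s'b(1)[of x] v by (intro exI[of _ "s' x - c0"]) auto
    qed
    then show "c0 * v \<le> s v" using s0 by simp
    have "c1 * 0 - s 0 \<le> c1 * v - s v"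
    proof (rule DERIV_nonneg_imp_nondecreasing[OF v(1)])
      fix x assume "0 \<le> x" "x \<le> v"
      moreover have "((\<lambda>v. c1 * v - s v) has_real_derivative c1 - s' x) (at x)"
        by (rule derivative_eq_intros ds refl | simp)+
      ultimately show "\<exists>y. ((\<lambda>v. c1 * v - s v) has_real_derivative y) (at x) \<and> 0 \<le> y"
        using s'b(2)[of x] v by (intro exI[of _ "c1 - s' x"]) auto
    qed
    then show "s v \<le> c1 * v" using s0 by simp
  qed
  have "AE x in circ. ereal \<bar>u0 x\<bar> \<le> ereal K"
    using esssup_AE[of "\<lambda>x. ereal \<bar>u0 x\<bar>" circ]
    by eventually_elim (rule order_trans[OF _ u0[unfolded Linfty_norm_def]])
  then show "AE x in circ. \<tau> * u0 x \<le> K"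
    by eventually_elim (use \<tau> in auto)
  show "continuous_on UNIV (deriv f)" by (rule C_infinity_continuous_on[OF C_infinity_deriv(2)[OF f]])
  show "\<kappa> * \<tau> \<in> {1, - 1}" using \<kappa> \<tau> by auto
  show "admissible_weak_solution \<alpha> f a T u0 u" if "0 < T" for T
    using u that unfolding global_solution_def by blast
qed (use \<alpha> K \<tau> c0 a in auto)

text \<open>The base point from which direction \<open>\<sigma>\<close> enters the arc above \<open>(l, l + \<rho>)\<close>.\<close>

definition entry_point :: "real \<Rightarrow> real \<Rightarrow> real \<Rightarrow> real"
  where "entry_point \<sigma> l \<rho> = (if \<sigma> = 1 then l else l + \<rho>)"

text \<open>
  Seen from its entry point, the arc over \<open>(l, l + \<rho>)\<close> occupies the positions \<open>(0, \<rho>)\<close> in either direction.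
\<close>

lemma in_arc_of_arc_coord:
  assumes \<sigma>: "\<sigma> \<in> {1, -1}" and x: "arc_coord \<sigma> (entry_point \<sigma> l \<rho>) x \<in> {0<..<\<rho>}"
  shows "\<exists>k::int. x + of_int k \<in> {l<..<l + \<rho>}"
proof (cases "\<sigma> = 1")
  case True
  then show ?thesis using x unfolding arc_coord_def entry_point_def frac_def
    by (intro exI[of _ "- \<lfloor>x - l\<rfloor>"]) auto
next
  case False
  then have "\<sigma> = -1" using \<sigma> by auto
  then show ?thesis using x unfolding arc_coord_def entry_point_def frac_def
    by (intro exI[of _ "\<lfloor>-1 * (x - (l + \<rho>))\<rfloor>"]) auto
qed

lemma arc_coord_of_in_arc:
  assumes \<sigma>: "\<sigma> \<in> {1, -1}" and \<rho>: "\<rho> \<le> 1" and e: "0 \<le> e"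
    and x: "x + of_int k \<in> {l + e<..<l + \<rho> - e}"
  shows "arc_coord \<sigma> (entry_point \<sigma> l \<rho>) x \<in> {e<..<\<rho>}"
proof (cases "\<sigma> = 1")
  case True
  have "frac (x - l) = x + of_int k - l"
    unfolding frac_unique_iff using x e \<rho> by auto
  then show ?thesis using True x e unfolding arc_coord_def entry_point_def by auto
next
  case False
  then have \<sigma>: "\<sigma> = -1" using \<sigma> by auto
  have "frac (l + \<rho> - x) = l + \<rho> - x - of_int k"
    unfolding frac_unique_iff using x e \<rho> by auto
  then show ?thesis using \<sigma> x e unfolding arc_coord_def entry_point_def by auto
qed

lemma open_arc_open:
  assumes "open_arc W" shows "open W"
proof -
  obtain l r where "W = {x. \<exists>k::int. x + of_int k \<in> {l<..<r}}" using assms unfolding open_arc_def by blast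
  then have "W = (\<Union>k::int. {l - of_int k<..<r - of_int k})" by auto (auto simp: algebra_simps)
  then show ?thesis by auto
qed

text \<open>
  A point of \<open>[0, 1)\<close> reaches the fundamental domain \<open>[l, l + 1)\<close> by one of two integer translations,
  and what is left of the arc there lies in an interval of length \<open>e\<close> at each end.  An arc with
  \<open>r - l \<ge> 1\<close> is the circle, possibly without the point over \<open>l\<close>, and counts as one of length \<open>1\<close>.
\<close>

lemma circ_measure_arc_minus_core:
  fixes l r e :: real
  defines "\<rho> \<equiv> min 1 (r - l)"
  defines "\<omega> \<equiv> {x. \<exists>k::int. x + of_int k \<in> {l<..<r}}"
    and "W \<equiv> {x. \<exists>k::int. x + of_int k \<in> {l + e<..<l + \<rho> - e}}"
  assumes e: "0 \<le> e" "2 * e < \<rho>"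
  shows "circ_measure (\<omega> - W) \<le> 4 * e"
proof -
  define A where "A n = {l + of_int n..l + of_int n + e} \<union> {l + of_int n + \<rho> - e..l + of_int n + \<rho>}" for n :: int
  define N where "N = \<lfloor>- l\<rfloor>"
  have Am: "A n \<in> lmeasurable" for n unfolding A_def by (intro fmeasurable.Un) auto
  have A_le: "measure lebesgue (A n) \<le> 2 * e" for n
  proof -
    have "measure lebesgue (A n) \<le> measure lebesgue {l + of_int n..l + of_int n + e}
        + measure lebesgue {l + of_int n + \<rho> - e..l + of_int n + \<rho>}"
      unfolding A_def by (intro measure_Un_le) auto
    also have "\<dots> = 2 * e" using e by simp
    finally show ?thesis .
  qed
  have sub: "(\<omega> - W) \<inter> {0..<1} \<subseteq> A N \<union> A (N + 1)"
  proof
    fix x assume x: "x \<in> (\<omega> - W) \<inter> {0..<1}"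
    define n where "n = \<lfloor>x - l\<rfloor>"
    define y where "y = x - l - of_int n"
    have y: "0 \<le> y" "y < 1" unfolding y_def n_def by linarith+
    have "n = N \<or> n = N + 1" using x unfolding n_def N_def by auto linarith
    moreover have "y \<le> e \<or> \<rho> - e \<le> y"
    proof (rule ccontr)
      assume "\<not> ?thesis"
      then have "x + of_int (- n) \<in> {l + e<..<l + \<rho> - e}" unfolding y_def by auto
      then show False using x unfolding W_def by blast
    qed
    moreover have "y \<le> \<rho>"
    proof (cases "r - l < 1")
      case True
      then have \<rho>: "\<rho> = r - l" unfolding \<rho>_def by simp
      obtain k :: int where k: "x + of_int k \<in> {l<..<r}" using x unfolding \<omega>_def by blast
      have "\<lfloor>x - l\<rfloor> = - k" using k True by (intro floor_unique) auto
      then show ?thesis using k unfolding y_def n_def \<rho> by auto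
    qed (use y in \<open>auto simp: \<rho>_def\<close>)
    ultimately have "x \<in> A n" using y unfolding A_def y_def by auto
    then show "x \<in> A N \<union> A (N + 1)" using \<open>n = N \<or> n = N + 1\<close> by auto
  qed
  have l_r: "l < r" "l + e < l + \<rho> - e" using e unfolding \<rho>_def by auto
  have "open_arc \<omega>" "open_arc W" unfolding open_arc_def \<omega>_def W_def using l_r by blast+
  then have "(\<omega> - W) \<inter> {0..<1} \<in> sets lebesgue"
    using open_arc_open by (intro sets.Int sets.Diff) auto
  then have "measure lebesgue ((\<omega> - W) \<inter> {0..<1}) \<le> measure lebesgue (A N \<union> A (N + 1))"
    using sub Am by (intro measure_mono_fmeasurable fmeasurable.Un) auto
  also have "\<dots> \<le> measure lebesgue (A N) + measure lebesgue (A (N + 1))"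
    using Am by (intro measure_Un_le fmeasurableD) auto
  also have "\<dots> \<le> 4 * e" using A_le[of N] A_le[of "N + 1"] by simp
  finally show ?thesis unfolding circ_measure_def .
qed

theorem theorem1p9:
  fixes \<alpha> K \<delta> :: real
    and f a u0 :: "real \<Rightarrow> real"
    and u :: "real \<Rightarrow> real \<Rightarrow> real"
    and \<omega> :: "real set"
  assumes alpha: "\<alpha> \<in> {0<..1}"
    and f_smooth: "C_infinity f"
    and K: "K > 0"
    and f'_0: "deriv f 0 = 0"
    and f''_inf: "(INF s\<in>{-K..K}. \<bar>deriv (deriv f) s\<bar>) > 0"
    and a: "condition_A a"
    and omega: "open_arc \<omega>"
    and delta: "\<delta> > 0" "\<And>x. x \<in> \<omega> \<Longrightarrow> a x \<ge> \<delta>"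
    and u0: "Linfty u0" "Linfty_norm u0 \<le> ereal K"
    and u: "global_solution \<alpha> f a u0 u"
  shows "\<exists>tstar>0. \<exists>C>0. \<forall>t\<ge>tstar.
    (\<exists>W. open_arc W \<and> W \<subseteq> \<omega> \<and> (AE x in circ. x \<in> W \<longrightarrow> u t x = 0) \<and>
         circ_measure (\<omega> - W) \<le> C / t powr (1 + \<alpha>)) \<and>
    Linfty_norm (u t) \<le> ereal (C / t)"
proof -
  have "continuous_on {-K..K} (deriv (deriv f))"
    by (intro C_infinity_continuous_on C_infinity_deriv f_smooth)
  then obtain \<kappa> c0 c1 where \<kappa>: "\<kappa> \<in> {1, -1}" and c0: "0 < c0"
    and f'': "\<And>s. s \<in> {-K..K} \<Longrightarrow> c0 \<le> \<kappa> * deriv (deriv f) s \<and> \<kappa> * deriv (deriv f) s \<le> c1"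
    by (rule convex_or_concave[OF _ K f''_inf]) (rule that, assumption+)
  note sol = one_sided_solutionI[OF alpha f_smooth K f'_0 \<kappa> c0 f'' a u0(2) u]
  have L1: "continuous_into_L1 u" using u unfolding global_solution_def by blast
  obtain l r where lr: "l < r" and \<omega>: "\<omega> = {x. \<exists>k::int. x + of_int k \<in> {l<..<r}}"
    using omega unfolding open_arc_def by blast
  define \<rho> where "\<rho> = min 1 (r - l)"
  have \<rho>: "0 < \<rho>" "\<rho> \<le> 1" "l + \<rho> \<le> r" unfolding \<rho>_def using lr by auto
  have one_side: "\<exists>C tstar. 0 < C \<and> 0 < tstar \<and> (\<forall>t\<ge>tstar.
      (AE x in circ. arc_coord (\<kappa> * \<tau>) (entry_point (\<kappa> * \<tau>) l \<rho>) x \<in> {C / t powr (1 + \<alpha>)<..<\<rho>} \<longrightarrow> \<tau> * u t x \<le> 0)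
      \<and> (AE x in circ. \<tau> * u t x \<le> C / t))"
    if \<tau>: "\<tau> \<in> {1, -1}" for \<tau>
  proof -
    interpret one_sided_solution \<alpha> K f a u0 u "\<kappa> * \<tau>" \<tau> c0 c1 by (rule sol[OF _ \<tau>])
    have damped: "\<delta> \<le> a x" if in_arc: "arc_coord (\<kappa> * \<tau>) (entry_point (\<kappa> * \<tau>) l \<rho>) x \<in> {0<..<\<rho>}" for x
    proof -
      obtain k :: int where "x + of_int k \<in> {l<..<l + \<rho>}" using in_arc_of_arc_coord[OF \<sigma> in_arc] by blast
      then have "x \<in> \<omega>" unfolding \<omega> using \<rho> by (intro CollectI exI[of _ k]) auto
      then show ?thesis by (rule delta(2))
    qed
    obtain C tstar where C: "0 < C" "0 < tstar"
      "\<And>t. tstar \<le> t \<Longrightarrow> le_after t (entry_point (\<kappa> * \<tau>) l \<rho>) {C / t powr (1 + \<alpha>)<..<\<rho>} 0"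
      "\<And>t. tstar \<le> t \<Longrightarrow> le_after t (entry_point (\<kappa> * \<tau>) l \<rho>) UNIV (C / t)"
      by (rule extinction_and_decay[OF \<rho>(1,2) delta(1) damped], assumption, rule that)
    have "(AE x in circ. arc_coord (\<kappa> * \<tau>) (entry_point (\<kappa> * \<tau>) l \<rho>) x \<in> {C / t powr (1 + \<alpha>)<..<\<rho>} \<longrightarrow> \<tau> * u t x \<le> 0)
      \<and> (AE x in circ. \<tau> * u t x \<le> C / t)" if t: "tstar \<le> t" for t
      using le_after_slice[OF L1 _ C(3)[OF t], of t] le_after_slice[OF L1 _ C(4)[OF t], of t] t C(2) by auto
    then show ?thesis using C(1,2) by blast
  qed
  obtain C1 t1 where C1: "0 < C1" "0 < t1" and
    up: "\<And>t. t1 \<le> t \<Longrightarrow> AE x in circ. arc_coord \<kappa> (entry_point \<kappa> l \<rho>) x \<in> {C1 / t powr (1 + \<alpha>)<..<\<rho>} \<longrightarrow> u t x \<le> 0"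
      "\<And>t. t1 \<le> t \<Longrightarrow> AE x in circ. u t x \<le> C1 / t"
    using one_side[of 1] by auto
  obtain C2 t2 where C2: "0 < C2" "0 < t2" and
    dn: "\<And>t. t2 \<le> t \<Longrightarrow> AE x in circ. arc_coord (-\<kappa>) (entry_point (-\<kappa>) l \<rho>) x \<in> {C2 / t powr (1 + \<alpha>)<..<\<rho>} \<longrightarrow> - u t x \<le> 0"
      "\<And>t. t2 \<le> t \<Longrightarrow> AE x in circ. - u t x \<le> C2 / t"
    using one_side[of "-1"] by auto
  define C where "C = max C1 C2"
  define tstar where "tstar = Max {1, t1, t2, 4 * C / \<rho>}"
  have C: "0 < C" unfolding C_def using C1 by auto
  have main: "(\<exists>W. open_arc W \<and> W \<subseteq> \<omega> \<and> (AE x in circ. x \<in> W \<longrightarrow> u t x = 0) \<and>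
         circ_measure (\<omega> - W) \<le> 4 * C / t powr (1 + \<alpha>)) \<and> Linfty_norm (u t) \<le> ereal (4 * C / t)"
    if t: "tstar \<le> t" for t
  proof
    have ts: "1 \<le> t" "t1 \<le> t" "t2 \<le> t" "4 * C / \<rho> \<le> t" using t unfolding tstar_def by auto
    define e where "e = C / t powr (1 + \<alpha>)"
    have e0: "0 < e" unfolding e_def using C ts by simp
    have e2: "2 * e < \<rho>"
    proof -
      have "t powr 1 \<le> t powr (1 + \<alpha>)" using ts alpha by (intro powr_mono) auto
      then have "e \<le> C / t" unfolding e_def using ts C by (intro divide_left_mono) auto
      moreover have "4 * C / t \<le> \<rho>" using ts \<rho> by (simp add: field_simps)
      ultimately show ?thesis using \<rho> by simp
    qed
    define W where "W = {x. \<exists>k::int. x + of_int k \<in> {l + e<..<l + \<rho> - e}}"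
    have "open_arc W" unfolding open_arc_def W_def using e2
      by (intro exI[of _ "l + e"] exI[of _ "l + \<rho> - e"]) auto
    moreover have "W \<subseteq> \<omega>"
    proof
      fix x assume "x \<in> W"
      then obtain k :: int where "x + of_int k \<in> {l + e<..<l + \<rho> - e}" unfolding W_def by blast
      then show "x \<in> \<omega>" unfolding \<omega> using e0 \<rho> by (intro CollectI exI[of _ k]) auto
    qed
    moreover have "AE x in circ. x \<in> W \<longrightarrow> u t x = 0"
      using up(1)[OF ts(2)] dn(1)[OF ts(3)]
    proof eventually_elim
      case (elim x)
      have "C1 / t powr (1 + \<alpha>) \<le> e" "C2 / t powr (1 + \<alpha>) \<le> e"
        unfolding e_def C_def by (auto intro!: divide_right_mono)
      moreover have "arc_coord \<sigma> (entry_point \<sigma> l \<rho>) x \<in> {e<..<\<rho>}" if "x \<in> W" "\<sigma> \<in> {1, -1}" for \<sigma>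
        using that(1) arc_coord_of_in_arc[OF that(2) \<rho>(2) less_imp_le[OF e0]] unfolding W_def by blast
      moreover have "- \<kappa> \<in> {1, -1}" using \<kappa> by auto
      ultimately show ?case using elim \<kappa> by fastforce
    qed
    moreover have "circ_measure (\<omega> - W) \<le> 4 * C / t powr (1 + \<alpha>)"
      using circ_measure_arc_minus_core[of e r l] e0 e2 unfolding \<omega> W_def \<rho>_def e_def by simp
    ultimately show "\<exists>W. open_arc W \<and> W \<subseteq> \<omega> \<and> (AE x in circ. x \<in> W \<longrightarrow> u t x = 0) \<and>
         circ_measure (\<omega> - W) \<le> 4 * C / t powr (1 + \<alpha>)" by blast
    have "AE x in circ. ereal \<bar>u t x\<bar> \<le> ereal (4 * C / t)"
      using up(2)[OF ts(2)] dn(2)[OF ts(3)]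
    proof eventually_elim
      case (elim x)
      have "C1 / t \<le> 4 * C / t" "C2 / t \<le> 4 * C / t"
        using C1 C2 ts unfolding C_def by (auto intro!: divide_right_mono)
      then show ?case using elim by auto
    qed
    moreover have "u t \<in> borel_measurable circ"
      using L1 ts unfolding continuous_into_L1_def by (auto intro: borel_measurable_integrable)
    then have "(\<lambda>x. ereal \<bar>u t x\<bar>) \<in> borel_measurable circ" by measurable
    ultimately show "Linfty_norm (u t) \<le> ereal (4 * C / t)" unfolding Linfty_norm_def by blast
  qed
  show ?thesis
    by (rule exI[of _ tstar], intro conjI exI[of _ "4 * C"] allI impI main) (use C in \<open>auto simp: tstar_def\<close>)
qed

end
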